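(* Let $(\nu_t)_{t\ge0}$ be the trajectory of a reversible continuous-time Markov chain with stationary distribution $\pi$, initialized at a distribution $\nu_0$, and suppose that $\pi$ satisfies a weak Poincaré inequality with constant $C_P>0$ and error functional $\mathrm{Error}$. Fix $T>0$, and let $\Lambda_T$ be the probability distribution on $[0,T]$ with density $\Lambda_T(s)=\frac{2C_P}{e^{2C_PT}-1}e^{2C_Ps}$. Then $$\chi^2(\nu_T\,\|\,\pi)\le e^{-2C_PT}\,\chi^2(\nu_0\,\|\,\pi)+\mathbb E_{s\sim\Lambda_T}\left[\mathrm{Error}\left(\frac{d\nu_s}{d\pi}\right)\right].$$
   Context: Let $(P_t)_{t\ge0}$ be the Markov semigroup on a state space $\Omega$, $P_tf(x)=\mathbb E[f(X_t)\mid X_0=x]$, reversible with respect to $\pi$, with infinitesimal generator $\mathcal L$ in the sign convention $P_t=e^{-t\mathcal L}$. The Dirichlet form is $\mathcal E(f,g)=\mathbb E_\pi[f\,\mathcal Lg]$. $\nu_t$ denotes the law of $X_t$ when $X_0\sim\nu_0$. $\pi$ satisfies a weak Poincaré inequality with constant $C_P>0$ and error functional $\mathrm{Error}:\mathbb R_{>0}^\Omega\to\mathbb R_{\ge0}$ if $\mathrm{Var}_\pi[f]\le\frac1{C_P}\mathcal E(f,f)+\mathrm{Error}(f)$ for all (admissible) $f$, in particular for the densities $d\nu_s/d\pi$, $s\in[0,T]$. $\chi^2(\nu\|\pi)=\mathrm{Var}_\pi\left[\frac{d\nu}{d\pi}\right]=\mathbb E_\pi\big[(d\nu/d\pi)^2\big]-1$.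 *)

theory Defs
  imports "HOL-Probability.Probability"
begin

definition square_integrable :: "'a measure \<Rightarrow> ('a \<Rightarrow> real) \<Rightarrow> bool" where
  "square_integrable \<pi> f \<longleftrightarrow> f \<in> borel_measurable \<pi> \<and> integrable \<pi> (\<lambda>x. (f x)\<^sup>2)"

text \<open>
  \<open>P t x\<close> is the law of \<open>X\<^sub>t\<close> given \<open>X\<^sub>0 = x\<close>. The semigroup is only meaningful for
  \<open>t \<ge> 0\<close>.
\<close>

definition semigroup_op :: "(real \<Rightarrow> 'a \<Rightarrow> 'a measure) \<Rightarrow> real \<Rightarrow> ('a \<Rightarrow> real) \<Rightarrow> 'a \<Rightarrow> real" where
  "semigroup_op P t f x = (\<integral>y. f y \<partial>P t x)"

text \<open>
  Strong continuity on \<open>L\<^sup>2(\<pi>)\<close> is what gives meaning to \<open>P\<^sub>t = e\<^bsup>-t\<L>\<^esup>\<close>.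
  Stationarity of \<open>\<pi>\<close> is the case \<open>A = space \<pi>\<close> of reversibility (detailed balance).
\<close>

locale reversible_markov_semigroup = prob_space \<pi>
  for \<pi> :: "'a measure" and P :: "real \<Rightarrow> 'a \<Rightarrow> 'a measure" +
  assumes kernel: "t \<ge> 0 \<Longrightarrow> P t \<in> measurable \<pi> (prob_algebra \<pi>)"
    and at_zero: "x \<in> space \<pi> \<Longrightarrow> P 0 x = return \<pi> x"
    and chapman_kolmogorov:
      "s \<ge> 0 \<Longrightarrow> t \<ge> 0 \<Longrightarrow> x \<in> space \<pi> \<Longrightarrow> P (s + t) x = bind (P s x) (P t)"
    and reversible: "t \<ge> 0 \<Longrightarrow> A \<in> sets \<pi> \<Longrightarrow> B \<in> sets \<pi> \<Longrightarrow>
      (\<integral>\<^sup>+x\<in>A. emeasure (P t x) B \<partial>\<pi>) = (\<integral>\<^sup>+x\<in>B. emeasure (P t x) A \<partial>\<pi>)"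
    and strongly_continuous: "square_integrable \<pi> f \<Longrightarrow>
      ((\<lambda>t. \<integral>x. (semigroup_op P t f x - f x)\<^sup>2 \<partial>\<pi>) \<longlongrightarrow> 0) (at_right 0)"

text \<open>
  \<open>is_generator \<pi> P f g\<close> says that \<open>f\<close> lies in the domain of the \<open>L\<^sup>2(\<pi>)\<close>-generator and
  \<open>\<L> f = g\<close>, where by the sign convention \<open>\<L> f = lim (f - P\<^sub>t f) / t\<close> as \<open>t\<close> decreases to \<open>0\<close>.
  Such a \<open>g\<close> is determined up to \<open>\<pi>\<close>-null sets, so the choice in \<open>generator\<close> does not affect
  the Dirichlet form.
\<close>

definition is_generator ::
  "'a measure \<Rightarrow> (real \<Rightarrow> 'a \<Rightarrow> 'a measure) \<Rightarrow> ('a \<Rightarrow> real) \<Rightarrow> ('a \<Rightarrow> real) \<Rightarrow> bool" where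
  "is_generator \<pi> P f g \<longleftrightarrow> square_integrable \<pi> f \<and> square_integrable \<pi> g \<and>
     ((\<lambda>t. \<integral>x. ((f x - semigroup_op P t f x) / t - g x)\<^sup>2 \<partial>\<pi>) \<longlongrightarrow> 0) (at_right 0)"

definition generator_domain ::
  "'a measure \<Rightarrow> (real \<Rightarrow> 'a \<Rightarrow> 'a measure) \<Rightarrow> ('a \<Rightarrow> real) set" where
  "generator_domain \<pi> P = {f. \<exists>g. is_generator \<pi> P f g}"

definition generator ::
  "'a measure \<Rightarrow> (real \<Rightarrow> 'a \<Rightarrow> 'a measure) \<Rightarrow> ('a \<Rightarrow> real) \<Rightarrow> 'a \<Rightarrow> real" where
  "generator \<pi> P f = (SOME g. is_generator \<pi> P f g)"

definition dirichlet_form ::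
  "'a measure \<Rightarrow> (real \<Rightarrow> 'a \<Rightarrow> 'a measure) \<Rightarrow> ('a \<Rightarrow> real) \<Rightarrow> ('a \<Rightarrow> real) \<Rightarrow> real" where
  "dirichlet_form \<pi> P f g = prob_space.expectation \<pi> (\<lambda>x. f x * generator \<pi> P g x)"

text \<open>
  \<open>Adm\<close> is the class of admissible test functions. The inequality is required only for those
  of them in the domain of \<open>\<L>\<close>, where \<open>\<E>(f, f) = \<E>\<^sub>\<pi>[f \<L> f]\<close> is defined.
\<close>

definition weak_poincare ::
  "'a measure \<Rightarrow> (real \<Rightarrow> 'a \<Rightarrow> 'a measure) \<Rightarrow> ('a \<Rightarrow> real) set \<Rightarrow> real \<Rightarrow> (('a \<Rightarrow> real) \<Rightarrow> real) \<Rightarrow> bool"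
where
  "weak_poincare \<pi> P Adm C Error \<longleftrightarrow>
     (\<forall>f\<in>Adm. Error f \<ge> 0) \<and>
     (\<forall>f\<in>Adm \<inter> generator_domain \<pi> P.
        prob_space.variance \<pi> f \<le> 1 / C * dirichlet_form \<pi> P f f + Error f)"

definition law_at :: "(real \<Rightarrow> 'a \<Rightarrow> 'a measure) \<Rightarrow> 'a measure \<Rightarrow> real \<Rightarrow> 'a measure" where
  "law_at P \<nu> t = bind \<nu> (P t)"

definition rel_density :: "'a measure \<Rightarrow> 'a measure \<Rightarrow> 'a \<Rightarrow> real" where
  "rel_density \<pi> \<nu> x = enn2real (RN_deriv \<pi> \<nu> x)"

text \<open>
  The variance of the relative density, with value \<open>\<infinity>\<close> if it is not square integrable and,
  by the usual convention, if \<open>\<nu>\<close> is not absolutely continuous with respect to \<open>\<pi>\<close>.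
\<close>

definition chi_square :: "'a measure \<Rightarrow> 'a measure \<Rightarrow> ennreal" where
  "chi_square \<pi> \<nu> =
     (if absolutely_continuous \<pi> \<nu>
      then \<integral>\<^sup>+x. ennreal ((rel_density \<pi> \<nu> x - prob_space.expectation \<pi> (rel_density \<pi> \<nu>))\<^sup>2) \<partial>\<pi>
      else \<infinity>)"

definition Lambda_density :: "real \<Rightarrow> real \<Rightarrow> real \<Rightarrow> real" where
  "Lambda_density C T s = 2 * C / (exp (2 * C * T) - 1) * exp (2 * C * s)"

definition Lambda :: "real \<Rightarrow> real \<Rightarrow> real measure" where
  "Lambda C T = density lborel (\<lambda>s. ennreal (Lambda_density C T s) * indicator {0..T} s)"

lemma prob_space_Lambda:
  assumes "C > 0" "T > 0"
  shows "prob_space (Lambda C T)"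
proof -
  define F where "F s = exp (2 * C * s) / (exp (2 * C * T) - 1)" for s
  have pos: "exp (2 * C * T) - 1 > 0" using assms by simp
  have "(\<integral>\<^sup>+s. ennreal (Lambda_density C T s) * indicator {0..T} s \<partial>lborel) = ennreal (F T - F 0)"
  proof (rule nn_integral_FTC_Icc)
    show "Lambda_density C T \<in> borel_measurable borel"
      unfolding Lambda_density_def by measurable
    have "(F has_real_derivative exp (2 * C * s) * (2 * C) / (exp (2 * C * T) - 1)) (at s)" for s
      unfolding F_def by (rule DERIV_cdivide) (auto intro!: derivative_eq_intros)
    then show "(F has_real_derivative Lambda_density C T s) (at s)" for s
      by (simp add: Lambda_density_def mult.commute)
    show "0 \<le> Lambda_density C T s" for s
      unfolding Lambda_density_def using pos assms by simp
  qed (use assms in simp)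
  also have "F T - F 0 = 1"
    using assms by (simp add: F_def diff_divide_distrib[symmetric])
  finally have total:
    "(\<integral>\<^sup>+s. ennreal (Lambda_density C T s) * indicator {0..T} s \<partial>lborel) = 1" by simp
  have [measurable]: "Lambda_density C T \<in> borel_measurable borel"
    unfolding Lambda_density_def by measurable
  show ?thesis
    unfolding Lambda_def by (rule prob_spaceI) (simp add: emeasure_density total)
qed

end

theory Submission
  imports Defs
begin

text \<open>
  If \<open>\<chi>\<^sup>2(\<nu>\<^sub>0 \<parallel> \<pi>)\<close> is finite then, by reversibility, \<open>d\<nu>\<^sub>t/d\<pi> = P\<^sub>t f\<close> for \<open>f = d\<nu>\<^sub>0/d\<pi>\<close>, and
  \<open>\<langle>P\<^sub>a f, P\<^sub>b f\<rangle> = \<phi>(a + b)\<close> for a single real function \<open>\<phi>\<close>; in particular the variance of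
  \<open>P\<^sub>t f\<close> is \<open>V t = \<phi>(2t) - 1\<close>. Where \<open>P\<^sub>t f\<close> is in the domain of \<open>\<L>\<close>, differentiation gives
  \<open>V' = -2 \<E>(P\<^sub>t f, P\<^sub>t f) \<le> 2 C\<^sub>P (Error(P\<^sub>t f) - V)\<close>, and integrating \<open>(e\<^bsup>2C\<^sub>Pt\<^esup> V)'\<close> over \<open>[0,T]\<close> gives
  the bound, since \<open>e\<^bsup>-2C\<^sub>PT\<^esup> \<le> 1 / (e\<^bsup>2C\<^sub>PT\<^esup> - 1)\<close>.

  That \<open>P\<^sub>t f\<close> is in the domain for every \<open>t > 0\<close> needs no spectral theorem. The functions \<open>\<phi>\<close> and
  \<open>s \<mapsto> \<phi>(s) - \<phi>(s + k)\<close> are convex, so the second difference quotients of \<open>\<phi>\<close> at \<open>2t\<close>,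
  which are the inner products of the difference quotients of \<open>s \<mapsto> P\<^sub>s f\<close> at \<open>t\<close>, are bounded and
  increase as the steps decrease. Hence they converge, and the difference quotients of
  \<open>s \<mapsto> P\<^sub>s f\<close> are Cauchy in \<open>L\<^sup>2\<close>.
\<close>

subsection \<open>Convexity and difference quotients\<close>

text \<open>Subtract the chord: the difference \<open>d\<close> is still midpoint convex and
  vanishes at both ends. A positive maximum would have a leftmost maximiser in the interior, and the
  midpoint inequality around it would produce another maximiser further left.\<close>

lemma midpoint_convex_imp_convex_on:
  fixes f :: "real \<Rightarrow> real"
  assumes S: "convex S" and cont: "continuous_on S f"
    and mid: "\<And>x y. x \<in> S \<Longrightarrow> y \<in> S \<Longrightarrow> f ((x + y) / 2) \<le> (f x + f y) / 2"
  shows "convex_on S f"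
proof (rule convex_on_linorderI[OF _ S])
  fix t x y :: real
  assume t: "0 < t" "t < 1" and xy: "x \<in> S" "y \<in> S" "x < y"
  have sub: "{x..y} \<subseteq> S"
    using closed_segment_subset[OF xy(1,2) S] xy(3) by (simp add: closed_segment_eq_real_ivl)
  define q where "q = (f y - f x) / (y - x)"
  have q: "(y - x) * q = f y - f x" using xy(3) by (simp add: q_def)
  define d where "d z = f z - (f x + (z - x) * q)" for z
  have d0: "d x = 0" "d y = 0" using q by (simp_all add: d_def)
  have cd: "continuous_on {x..y} d"
    unfolding d_def by (intro continuous_intros continuous_on_subset[OF cont sub])
  have dmid: "d ((a + b) / 2) \<le> (d a + d b) / 2" if "a \<in> {x..y}" "b \<in> {x..y}" for a b
  proof -
    have "f ((a + b) / 2) \<le> (f a + f b) / 2" using that sub by (intro mid) auto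
    moreover have "((a + b) / 2 - x) * q = ((a - x) * q + (b - x) * q) / 2"
      by (simp add: algebra_simps)
    moreover have "u \<le> (v + w) / 2 \<Longrightarrow> p = (p' + p'') / 2 \<Longrightarrow>
        u - (z + p) \<le> ((v - (z + p')) + (w - (z + p''))) / 2" for u v w p p' p'' z :: real
      by (simp add: field_simps)
    ultimately show ?thesis unfolding d_def by blast
  qed
  obtain m where m: "m \<in> {x..y}" "\<And>z. z \<in> {x..y} \<Longrightarrow> d z \<le> d m"
    using continuous_attains_sup[OF _ _ cd] xy(3) by auto
  have "d m \<le> 0"
  proof (rule ccontr)
    assume "\<not> d m \<le> 0"
    let ?K = "{z \<in> {x..y}. d z = d m}"
    have "compact ?K"
      using continuous_closed_preimage_constant[OF cd, of "d m"]
      by (simp add: compact_eq_bounded_closed bounded_subset[of "{x..y}"] subset_iff)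
    then obtain c where c: "c \<in> ?K" "\<And>z. z \<in> ?K \<Longrightarrow> c \<le> z"
      using compact_attains_inf[of ?K] m(1) by blast
    have "x < c" "c < y" using c(1) d0 \<open>\<not> d m \<le> 0\<close> by (auto simp: less_le)
    define e where "e = min (c - x) (y - c)"
    have e: "e > 0" "c - e \<in> {x..y}" "c + e \<in> {x..y}"
      using \<open>x < c\<close> \<open>c < y\<close> by (auto simp: e_def)
    have "d c \<le> (d (c - e) + d (c + e)) / 2" using dmid[OF e(2,3)] by simp
    then have "d (c - e) = d m" using m(2)[OF e(2)] m(2)[OF e(3)] c(1) by auto
    then show False using c(2)[of "c - e"] e by auto
  qed
  let ?z = "(1 - t) *\<^sub>R x + t *\<^sub>R y"
  have zx: "?z - x = t * (y - x)" by (simp add: algebra_simps)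
  have "?z \<in> {x..y}"
  proof -
    have "0 \<le> t * (y - x)" "t * (y - x) \<le> 1 * (y - x)"
      using t xy(3) by (auto intro: mult_right_mono)
    then show ?thesis using zx by auto
  qed
  then have "d ?z \<le> 0" using m(2) \<open>d m \<le> 0\<close> by (meson order_trans)
  moreover have "(?z - x) * q = t * (f y - f x)" unfolding zx using q by (simp add: mult.assoc)
  ultimately show "f ?z \<le> (1 - t) * f x + t * f y"
    unfolding d_def by (simp add: algebra_simps)
qed

lemma convex_on_slope_antimono:
  fixes f :: "real \<Rightarrow> real"
  assumes "convex_on I f" "s \<in> I" "s + k \<in> I" "0 < h" "h \<le> k"
  shows "(f s - f (s + k)) / k \<le> (f s - f (s + h)) / h"
proof (cases "h = k")
  case False
  then have "(f s - f (s + h)) / (s - (s + h)) \<le> (f s - f (s + k)) / (s - (s + k))"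
    using assms by (intro convex_on_slope_le(1)[OF assms(1)]) auto
  then show ?thesis by simp
qed simp

text \<open>The rate of decrease past \<open>b\<close>, however small the step \<open>h\<close>, is
  controlled by a fixed chord to the left of \<open>b\<close>. This supplies bounds uniform in
  \<open>h\<close>.\<close>

lemma convex_on_slope_chain:
  fixes f :: "real \<Rightarrow> real"
  assumes "convex_on I f" "a \<in> I" "b + h \<in> I" "a < b" "0 < h"
  shows "(f b - f (b + h)) / h \<le> (f a - f b) / (b - a)"
proof -
  have "(f a - f b) / (a - b) \<le> (f b - f (b + h)) / (b - (b + h))"
    using convex_on_slope_le[OF assms(1,2,3) assms(4)] assms(5) by force
  moreover have "(f a - f b) / (a - b) = - ((f a - f b) / (b - a))"
    using minus_divide_right[of "f a - f b" "b - a"] by simp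
  moreover have "(f b - f (b + h)) / (b - (b + h)) = - ((f b - f (b + h)) / h)" by simp
  ultimately show ?thesis by linarith
qed

text \<open>The quotient \<open>F h k\<close> is symmetric, and convexity of
  \<open>\<phi> s - \<phi> (s + k)\<close> makes it grow as either step shrinks. Chords to the left
  of \<open>s\<close> bound it, so the supremum over the diagonal is its limit, jointly in
  \<open>h\<close> and \<open>k\<close>.\<close>

lemma second_difference_quotient_converges:
  fixes \<phi> :: "real \<Rightarrow> real"
  assumes cvx: "convex_on {0..} \<phi>"
    and cvx2: "\<And>k. k \<ge> 0 \<Longrightarrow> convex_on {0..} (\<lambda>s. \<phi> s - \<phi> (s + k))"
    and nonneg: "\<And>s. s \<ge> 0 \<Longrightarrow> \<phi> s \<ge> 0"
    and anti: "\<And>s k. s \<ge> 0 \<Longrightarrow> k \<ge> 0 \<Longrightarrow> \<phi> (s + k) \<le> \<phi> s"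
    and "s > 0"
  obtains L where "\<And>e. e > 0 \<Longrightarrow> \<exists>d>0. \<forall>h k. 0 < h \<and> h < d \<and> 0 < k \<and> k < d \<longrightarrow>
    \<bar>(\<phi> s - \<phi> (s + h) - \<phi> (s + k) + \<phi> (s + h + k)) / (h * k) - L\<bar> < e"
proof -
  define F where "F h k = (\<phi> s - \<phi> (s + h) - \<phi> (s + k) + \<phi> (s + h + k)) / (h * k)" for h k
  have sym: "F h k = F k h" for h k by (simp add: F_def add_ac mult.commute)
  have F_eq: "F h k = ((\<phi> s - \<phi> (s + k)) - (\<phi> (s + h) - \<phi> (s + h + k))) / h / k" for h k
    by (simp add: F_def algebra_simps)
  \<comment> \<open>For fixed \<open>k\<close>, \<open>F h k\<close> is a slope of
    \<open>\<phi> s - \<phi> (s + k)\<close> in \<open>s\<close>, divided by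
    \<open>k\<close>.\<close>
  have mono1: "F h' k \<le> F h k" if "0 < h" "h \<le> h'" "0 < k" for h h' k
    unfolding F_eq using convex_on_slope_antimono[OF cvx2[of k], of s h' h] that \<open>s > 0\<close>
    by (intro divide_right_mono) auto
  have mono: "F h' k' \<le> F h k" if "0 < h" "h \<le> h'" "0 < k" "k \<le> k'" for h h' k k'
  proof -
    have "F h' k' \<le> F h k'" using that by (intro mono1) auto
    also have "\<dots> \<le> F h k" unfolding sym[of h] using that by (intro mono1) auto
    finally show ?thesis .
  qed
  \<comment> \<open>Two chord comparisons, over \<open>[s/2, s]\<close> for the step
    \<open>h\<close> and over \<open>[0, s/2]\<close> for the step \<open>k\<close>, each leave a
    divisor \<open>s / 2\<close>. Dropping subtracted nonnegative terms leaves
    \<open>\<phi> 0\<close>.\<close>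
  define B where "B = \<phi> 0 / (s / 2) / (s / 2)"
  have bound: "F h k \<le> B" if "0 < h" "0 < k" for h k
  proof -
    have "((\<phi> s - \<phi> (s + k)) - (\<phi> (s + h) - \<phi> (s + h + k))) / h
        \<le> ((\<phi> (s/2) - \<phi> (s/2 + k)) - (\<phi> s - \<phi> (s + k))) / (s - s/2)"
      using convex_on_slope_chain[OF cvx2[of k], of "s/2" s h] that \<open>s > 0\<close> by auto
    also have "\<dots> \<le> (\<phi> (s/2) - \<phi> (s/2 + k)) / (s / 2)"
      using anti[of s k] that \<open>s > 0\<close> by (simp add: divide_right_mono)
    finally have "F h k \<le> (\<phi> (s/2) - \<phi> (s/2 + k)) / (s / 2) / k"
      unfolding F_eq using that by (intro divide_right_mono) auto
    also have "\<dots> = (\<phi> (s/2) - \<phi> (s/2 + k)) / k / (s / 2)" by simp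
    also have "(\<phi> (s/2) - \<phi> (s/2 + k)) / k \<le> (\<phi> 0 - \<phi> (s/2)) / (s/2 - 0)"
      using convex_on_slope_chain[OF cvx, of 0 "s/2" k] that \<open>s > 0\<close> by auto
    also have "\<dots> \<le> \<phi> 0 / (s / 2)"
      using nonneg[of "s/2"] \<open>s > 0\<close> by (simp add: divide_right_mono)
    finally show ?thesis using \<open>s > 0\<close> unfolding B_def by (simp add: divide_right_mono)
  qed
  define L where "L = (SUP h\<in>{0<..}. F h h)"
  have bdd: "bdd_above ((\<lambda>h. F h h) ` {0<..})" by (rule bdd_aboveI2[where M = B]) (simp add: bound)
  show thesis
  proof (rule that[of L])
    fix e :: real assume "e > 0"
    obtain h0 where h0: "h0 > 0" "L - e < F h0 h0"
      using less_cSUP_iff[OF _ bdd, of "L - e"] \<open>e > 0\<close> unfolding L_def by auto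
    have "\<bar>F h k - L\<bar> < e" if "0 < h" "h < h0" "0 < k" "k < h0" for h k
    proof -
      \<comment> \<open>Monotonicity traps \<open>F h k\<close> between two diagonal values, one at
        the near-optimal \<open>h0\<close> and one at the smaller of the two steps.\<close>
      have "F h0 h0 \<le> F h k" using that by (intro mono) auto
      moreover have "F h k \<le> F (min h k) (min h k)" using that by (intro mono) auto
      moreover have "F (min h k) (min h k) \<le> L"
        unfolding L_def using that by (intro cSUP_upper[OF _ bdd]) auto
      ultimately show ?thesis using h0 \<open>e > 0\<close> by linarith
    qed
    then show "\<exists>d>0. \<forall>h k. 0 < h \<and> h < d \<and> 0 < k \<and> k < d \<longrightarrow>
      \<bar>(\<phi> s - \<phi> (s + h) - \<phi> (s + k) + \<phi> (s + h + k)) / (h * k) - L\<bar> < e"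
      using h0(1) unfolding F_def by blast
  qed
qed

subsection \<open>Square-integrable functions\<close>

lemma square_integrable_measurable [measurable_dest]:
  "square_integrable M f \<Longrightarrow> f \<in> borel_measurable M"
  by (simp add: square_integrable_def)

lemma square_integrable_mult:
  assumes f: "square_integrable M f" and g: "square_integrable M g"
  shows "integrable M (\<lambda>x. f x * g x)"
proof (rule Bochner_Integration.integrable_bound)
  show "integrable M (\<lambda>x. (f x)\<^sup>2 + (g x)\<^sup>2)"
    using assms by (auto simp: square_integrable_def)
  have "\<bar>a * b\<bar> \<le> a\<^sup>2 + b\<^sup>2" for a b :: real
    using sum_squares_bound[of a b] sum_squares_bound[of a "-b"] by (simp add: abs_le_iff)
  then show "AE x in M. norm (f x * g x) \<le> norm ((f x)\<^sup>2 + (g x)\<^sup>2)"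
    by (auto simp: abs_of_nonneg)
  show "(\<lambda>x. f x * g x) \<in> borel_measurable M" using f g by measurable
qed

lemma square_integrable_diff:
  assumes f: "square_integrable M f" and g: "square_integrable M g"
  shows "square_integrable M (\<lambda>x. f x - g x)"
  unfolding square_integrable_def
proof
  show "(\<lambda>x. f x - g x) \<in> borel_measurable M" using f g by measurable
  have "(\<lambda>x. (f x - g x)\<^sup>2) = (\<lambda>x. (f x)\<^sup>2 + (g x)\<^sup>2 - 2 * (f x * g x))"
    by (auto simp: power2_diff)
  then show "integrable M (\<lambda>x. (f x - g x)\<^sup>2)"
    using assms square_integrable_mult[OF assms] by (auto simp: square_integrable_def)
qed

lemma square_integrable_divide:
  "square_integrable M f \<Longrightarrow> square_integrable M (\<lambda>x. f x / c)"
  by (auto simp: square_integrable_def power_divide)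

lemma square_integrable_cong_AE:
  assumes "square_integrable M f" "g \<in> borel_measurable M" "AE x in M. f x = g x"
  shows "square_integrable M g"
proof -
  have "integrable M (\<lambda>x. (f x)\<^sup>2) \<longleftrightarrow> integrable M (\<lambda>x. (g x)\<^sup>2)"
    using assms by (intro integrable_cong_AE) (auto simp: square_integrable_def)
  then show ?thesis using assms by (simp add: square_integrable_def)
qed

text \<open>The version for extended nonnegative integrals is applied to absolute values. Square
  integrability makes every integral finite, so the result can be read back in the reals.\<close>

lemma Cauchy_Schwarz_integral:
  assumes f: "square_integrable M f" and g: "square_integrable M g"
  shows "(\<integral>x. f x * g x \<partial>M)\<^sup>2 \<le> (\<integral>x. (f x)\<^sup>2 \<partial>M) * (\<integral>x. (g x)\<^sup>2 \<partial>M)"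
proof -
  note [measurable] = square_integrable_measurable[OF f] square_integrable_measurable[OF g]
  note int = square_integrable_mult[OF f g]
  have sq: "integrable M (\<lambda>x. (f x)\<^sup>2)" "integrable M (\<lambda>x. (g x)\<^sup>2)"
    using f g by (auto simp: square_integrable_def)
  have "ennreal ((\<integral>x. \<bar>f x * g x\<bar> \<partial>M)\<^sup>2) = (\<integral>\<^sup>+x. ennreal \<bar>f x\<bar> * ennreal \<bar>g x\<bar> \<partial>M)\<^sup>2"
  proof -
    have "(\<integral>\<^sup>+x. ennreal \<bar>f x\<bar> * ennreal \<bar>g x\<bar> \<partial>M) = (\<integral>\<^sup>+x. ennreal \<bar>f x * g x\<bar> \<partial>M)"
      by (simp add: abs_mult ennreal_mult)
    also have "\<dots> = ennreal (\<integral>x. \<bar>f x * g x\<bar> \<partial>M)"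
      using int by (intro nn_integral_eq_integral) auto
    finally show ?thesis by (simp add: ennreal_power)
  qed
  also have "\<dots> \<le> (\<integral>\<^sup>+x. (ennreal \<bar>f x\<bar>)\<^sup>2 \<partial>M) * (\<integral>\<^sup>+x. (ennreal \<bar>g x\<bar>)\<^sup>2 \<partial>M)"
    by (rule Cauchy_Schwarz_nn_integral) measurable
  also have "\<dots> = ennreal ((\<integral>x. (f x)\<^sup>2 \<partial>M) * (\<integral>x. (g x)\<^sup>2 \<partial>M))"
    using sq by (simp add: ennreal_power nn_integral_eq_integral ennreal_mult)
  finally have "(\<integral>x. \<bar>f x * g x\<bar> \<partial>M)\<^sup>2 \<le> (\<integral>x. (f x)\<^sup>2 \<partial>M) * (\<integral>x. (g x)\<^sup>2 \<partial>M)"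
    by (subst (asm) ennreal_le_iff) auto
  moreover have "\<bar>\<integral>x. f x * g x \<partial>M\<bar> \<le> (\<integral>x. \<bar>f x * g x\<bar> \<partial>M)" by (rule integral_abs_bound)
  then have "(\<integral>x. f x * g x \<partial>M)\<^sup>2 \<le> (\<integral>x. \<bar>f x * g x\<bar> \<partial>M)\<^sup>2"
    using power_mono[of "\<bar>\<integral>x. f x * g x \<partial>M\<bar>" _ 2] by simp
  ultimately show ?thesis by linarith
qed

text \<open>Expanding around the limits leaves three error terms, each with a factor tending to 0 in
  norm, so Cauchy-Schwarz removes them. Square integrability is asked only eventually because times
  \<open>t - h\<close> will occur, which are meaningful for small \<open>h\<close> only.\<close>

lemma tendsto_integral_mult_L2:
  assumes u: "\<forall>\<^sub>F h in F. square_integrable M (u h)" and v: "\<forall>\<^sub>F h in F. square_integrable M (v h)"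
    and u0: "square_integrable M u0" and v0: "square_integrable M v0"
    and cu: "((\<lambda>h. \<integral>x. (u h x - u0 x)\<^sup>2 \<partial>M) \<longlongrightarrow> 0) F"
    and cv: "((\<lambda>h. \<integral>x. (v h x - v0 x)\<^sup>2 \<partial>M) \<longlongrightarrow> 0) F"
  shows "((\<lambda>h. \<integral>x. u h x * v h x \<partial>M) \<longlongrightarrow> (\<integral>x. u0 x * v0 x \<partial>M)) F"
proof -
  have CS0: "((\<lambda>h. \<integral>x. a h x * b h x \<partial>M) \<longlongrightarrow> 0) F"
    if "\<forall>\<^sub>F h in F. square_integrable M (a h) \<and> square_integrable M (b h)"
      and lim: "((\<lambda>h. (\<integral>x. (a h x)\<^sup>2 \<partial>M) * (\<integral>x. (b h x)\<^sup>2 \<partial>M)) \<longlongrightarrow> 0) F" for a b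
  proof -
    have "\<forall>\<^sub>F h in F. (\<integral>x. a h x * b h x \<partial>M)\<^sup>2 \<le> (\<integral>x. (a h x)\<^sup>2 \<partial>M) * (\<integral>x. (b h x)\<^sup>2 \<partial>M)"
      using that(1) by eventually_elim (simp add: Cauchy_Schwarz_integral)
    then have "((\<lambda>h. (\<integral>x. a h x * b h x \<partial>M)\<^sup>2) \<longlongrightarrow> 0) F"
      by (intro tendsto_sandwich[OF _ _ tendsto_const lim]) auto
    then have "((\<lambda>h. sqrt ((\<integral>x. a h x * b h x \<partial>M)\<^sup>2)) \<longlongrightarrow> sqrt 0) F"
      by (rule tendsto_real_sqrt)
    then show ?thesis by (simp add: tendsto_rabs_zero_iff)
  qed
  note uv = eventually_conj[OF u v]
  have 1: "((\<lambda>h. \<integral>x. (u h x - u0 x) * (v h x - v0 x) \<partial>M) \<longlongrightarrow> 0) F"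
    using tendsto_mult[OF cu cv]
    by (intro CS0 eventually_mono[OF uv]) (auto intro: square_integrable_diff u0 v0)
  have 2: "((\<lambda>h. \<integral>x. u0 x * (v h x - v0 x) \<partial>M) \<longlongrightarrow> 0) F"
    using tendsto_mult[OF tendsto_const cv]
    by (intro CS0 eventually_mono[OF uv]) (auto intro: square_integrable_diff u0 v0)
  have 3: "((\<lambda>h. \<integral>x. (u h x - u0 x) * v0 x \<partial>M) \<longlongrightarrow> 0) F"
    using tendsto_mult[OF cu tendsto_const]
    by (intro CS0 eventually_mono[OF uv]) (auto intro: square_integrable_diff u0 v0)
  have "\<forall>\<^sub>F h in F. (\<integral>x. (u h x - u0 x) * (v h x - v0 x) \<partial>M) + (\<integral>x. u0 x * (v h x - v0 x) \<partial>M)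
     + (\<integral>x. (u h x - u0 x) * v0 x \<partial>M) + (\<integral>x. u0 x * v0 x \<partial>M) = (\<integral>x. u h x * v h x \<partial>M)"
    using uv
  proof eventually_elim
    case (elim h)
    note du = square_integrable_diff[OF conjunct1[OF elim] u0]
      and dv = square_integrable_diff[OF conjunct2[OF elim] v0]
    note I = square_integrable_mult[OF du dv] square_integrable_mult[OF u0 dv]
      square_integrable_mult[OF du v0] square_integrable_mult[OF u0 v0]
    have "(\<lambda>x. u h x * v h x) = (\<lambda>x. (u h x - u0 x) * (v h x - v0 x) + u0 x * (v h x - v0 x)
      + (u h x - u0 x) * v0 x + u0 x * v0 x)" by (simp add: algebra_simps)
    then show ?case using I by simp
  qed
  from Lim_transform_eventually[OF tendsto_add[OF tendsto_add[OF tendsto_add[OF 1 2] 3] tendsto_const] this]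
  show ?thesis by simp
qed

text \<open>Sampling at \<open>1 / (n + 1)\<close> gives an L1-Cauchy sequence, hence a subsequence
  converging almost everywhere. Fatou's lemma carries the L2 Cauchy bound to its limit for every
  small \<open>h\<close>, not only the sampled ones.\<close>

lemma (in prob_space) L2_complete_at_right:
  assumes D: "\<And>h. h > 0 \<Longrightarrow> square_integrable M (D h)"
    and Cauchy: "\<And>e. e > 0 \<Longrightarrow> \<exists>d>0. \<forall>h k. 0 < h \<and> h < d \<and> 0 < k \<and> k < d \<longrightarrow>
      (\<integral>x. (D h x - D k x)\<^sup>2 \<partial>M) < e"
  obtains g where "square_integrable M g"
    "((\<lambda>h::real. \<integral>x. (D h x - g x)\<^sup>2 \<partial>M) \<longlongrightarrow> 0) (at_right 0)"
proof -
  define s where "s n = D (inverse (real (Suc n)))" for n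
  have sq: "square_integrable M (s n)" for n by (simp add: s_def D)
  note [measurable] = square_integrable_measurable[OF sq]
  have L2: "\<exists>N. \<forall>i\<ge>N. inverse (real (Suc i)) < d" if "d > 0" for d
    using order_tendstoD(2)[OF LIMSEQ_inverse_real_of_nat that]
    by (simp only: eventually_sequentially)
  \<comment> \<open>Pairing the differences with the constant 1 in Cauchy-Schwarz bounds the L1 norm
    by the L2 norm, since the total mass is 1.\<close>
  have one: "square_integrable M (\<lambda>_. 1)" by (simp add: square_integrable_def)
  have L1: "\<exists>N. \<forall>i\<ge>N. \<forall>j\<ge>N. (LINT x|M. norm (s i x - s j x)) < e" if e: "e > 0" for e
  proof -
    obtain d where d: "d > 0" "\<And>h k. 0 < h \<Longrightarrow> h < d \<Longrightarrow> 0 < k \<Longrightarrow> k < d \<Longrightarrow>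
      (\<integral>x. (D h x - D k x)\<^sup>2 \<partial>M) < e\<^sup>2"
      using Cauchy[of "e\<^sup>2"] zero_less_power[OF e, of 2] by blast
    obtain N where N: "\<And>i. i \<ge> N \<Longrightarrow> inverse (real (Suc i)) < d" using L2[OF d(1)] by auto
    have "(LINT x|M. norm (s i x - s j x)) < e" if "i \<ge> N" "j \<ge> N" for i j
    proof -
      have "square_integrable M (\<lambda>x. \<bar>s i x - s j x\<bar>)"
        using square_integrable_diff[OF sq[of i] sq[of j]] by (simp add: square_integrable_def)
      from Cauchy_Schwarz_integral[OF this one]
      have "(LINT x|M. norm (s i x - s j x))\<^sup>2 \<le> (\<integral>x. (s i x - s j x)\<^sup>2 \<partial>M)"
        by (simp add: prob_space)
      also have "\<dots> < e\<^sup>2" unfolding s_def by (rule d(2)) (use N that in auto)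
      finally show ?thesis using \<open>e > 0\<close> by (simp add: power_less_imp_less_base)
    qed
    then show ?thesis by blast
  qed
  have "integrable M (s n)" for n
    using square_integrable_imp_integrable[of "s n"] sq[of n] by (simp add: square_integrable_def)
  from cauchy_L1_AE_cauchy_subseq[OF this L1] obtain r
    where r: "strict_mono r" "AE x in M. Cauchy (\<lambda>i. s (r i) x)" by blast
  define g where "g x = lim (\<lambda>i. s (r i) x)" for x
  have [measurable]: "g \<in> borel_measurable M" unfolding g_def by measurable
  have conv: "AE x in M. (\<lambda>i. s (r i) x) \<longlonglongrightarrow> g x"
    using r(2) by eventually_elim (simp add: g_def Cauchy_convergent convergent_LIMSEQ_iff[symmetric])
  have fatou: "\<exists>d>0. \<forall>h. 0 < h \<and> h < d \<longrightarrow> (\<integral>\<^sup>+x. ennreal ((D h x - g x)\<^sup>2) \<partial>M) \<le> ennreal e"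
    if e: "e > 0" for e
  proof -
    obtain d where d: "d > 0" "\<And>h k. 0 < h \<Longrightarrow> h < d \<Longrightarrow> 0 < k \<Longrightarrow> k < d \<Longrightarrow>
      (\<integral>x. (D h x - D k x)\<^sup>2 \<partial>M) < e"
      using Cauchy[OF e] by blast
    obtain N where N: "\<And>i. i \<ge> N \<Longrightarrow> inverse (real (Suc i)) < d" using L2[OF d(1)] by auto
    have "(\<integral>\<^sup>+x. ennreal ((D h x - g x)\<^sup>2) \<partial>M) \<le> ennreal e" if h: "0 < h" "h < d" for h
    proof -
      note [measurable] = square_integrable_measurable[OF D[OF h(1)]]
      have "(\<integral>\<^sup>+x. ennreal ((D h x - g x)\<^sup>2) \<partial>M)
          = (\<integral>\<^sup>+x. liminf (\<lambda>i. ennreal ((D h x - s (r i) x)\<^sup>2)) \<partial>M)"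
      proof (rule nn_integral_cong_AE, use conv in eventually_elim)
        case (elim x)
        have "(\<lambda>i. ennreal ((D h x - s (r i) x)\<^sup>2)) \<longlonglongrightarrow> ennreal ((D h x - g x)\<^sup>2)"
          by (intro tendsto_ennrealI tendsto_intros elim)
        then show ?case by (rule lim_imp_Liminf[OF sequentially_bot, symmetric])
      qed
      also have "\<dots> \<le> liminf (\<lambda>i. \<integral>\<^sup>+x. ennreal ((D h x - s (r i) x)\<^sup>2) \<partial>M)"
        by (rule nn_integral_liminf) measurable
      also have "\<dots> \<le> ennreal e"
      proof (rule Liminf_le)
        have "(\<integral>\<^sup>+x. ennreal ((D h x - s (r i) x)\<^sup>2) \<partial>M) \<le> ennreal e" if "i \<ge> N" for i
        proof -
          have "(\<integral>\<^sup>+x. ennreal ((D h x - s (r i) x)\<^sup>2) \<partial>M)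
              = ennreal (\<integral>x. (D h x - s (r i) x)\<^sup>2 \<partial>M)"
            using square_integrable_diff[OF D[OF h(1)] sq[of "r i"]]
            by (intro nn_integral_eq_integral) (auto simp: square_integrable_def)
          also have "\<dots> \<le> ennreal e"
          proof (intro ennreal_leI less_imp_le)
            have "r i \<ge> N" using that seq_suble[OF r(1), of i] by linarith
            then show "(\<integral>x. (D h x - s (r i) x)\<^sup>2 \<partial>M) < e"
              unfolding s_def by (intro d(2) h) (use N in auto)
          qed
          finally show ?thesis .
        qed
        then show "\<forall>\<^sub>F i in sequentially. (\<integral>\<^sup>+x. ennreal ((D h x - s (r i) x)\<^sup>2) \<partial>M) \<le> ennreal e"
          by (auto simp: eventually_sequentially)
      qed simp
      finally show ?thesis .
    qed
    then show ?thesis using d(1) by blast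
  qed
  have g: "square_integrable M g"
  proof -
    obtain d where d: "d > 0" "\<And>h. 0 < h \<Longrightarrow> h < d \<Longrightarrow> (\<integral>\<^sup>+x. ennreal ((D h x - g x)\<^sup>2) \<partial>M) \<le> ennreal 1"
      using fatou[OF zero_less_one] by blast
    have "(\<integral>\<^sup>+x. ennreal ((D (d/2) x - g x)\<^sup>2) \<partial>M) < \<infinity>"
      using d(2)[of "d/2"] d(1) by (simp add: order_le_less_trans)
    moreover have [measurable]: "D (d/2) \<in> borel_measurable M"
      using d(1) by (intro square_integrable_measurable D) simp
    ultimately have "square_integrable M (\<lambda>x. D (d/2) x - g x)"
      by (simp add: square_integrable_def integrable_iff_bounded)
    \<comment> \<open>\<open>g\<close> is recovered as
      \<open>D (d/2) - (D (d/2) - g)\<close>.\<close>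
    from square_integrable_diff[OF D[of "d/2"] this] d(1) show ?thesis by simp
  qed
  moreover have "((\<lambda>h. \<integral>x. (D h x - g x)\<^sup>2 \<partial>M) \<longlongrightarrow> 0) (at_right 0)"
  proof (rule tendstoI)
    fix e :: real assume "e > 0"
    obtain d where d: "d > 0"
      "\<And>h. 0 < h \<Longrightarrow> h < d \<Longrightarrow> (\<integral>\<^sup>+x. ennreal ((D h x - g x)\<^sup>2) \<partial>M) \<le> ennreal (e/2)"
      using fatou[OF half_gt_zero[OF \<open>e > 0\<close>]] by blast
    have "(\<integral>x. (D h x - g x)\<^sup>2 \<partial>M) < e" if "0 < h" "h < d" for h
    proof -
      have "ennreal (\<integral>x. (D h x - g x)\<^sup>2 \<partial>M) \<le> ennreal (e/2)"
        using d(2)[OF that] square_integrable_diff[OF D[OF that(1)] g]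
        by (subst nn_integral_eq_integral[symmetric]) (auto simp: square_integrable_def)
      then show ?thesis using \<open>e > 0\<close> by (simp add: ennreal_le_iff)
    qed
    then show "\<forall>\<^sub>F h in at_right 0. dist (\<integral>x. (D h x - g x)\<^sup>2 \<partial>M) 0 < e"
      using d(1) by (auto simp: eventually_at_right_field intro!: exI[of _ d])
  qed
  ultimately show thesis by (rule that)
qed

subsection \<open>A Gronwall inequality\<close>

text \<open>The integrating factor is \<open>exp (2 * C * s)\<close>. Differentiability is asked
  only in the open interval, as the initial density need not lie in the domain of the generator. A
  divergent error integral makes the bound in \<open>ennreal\<close> trivial.\<close>

lemma Gronwall_Lambda:
  assumes C: "C > 0" and T: "T > 0"
    and cont: "continuous_on {0..T} V"
    and der: "\<And>s. 0 < s \<Longrightarrow> s < T \<Longrightarrow> (V has_real_derivative V' s) (at s)"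
    and le: "\<And>s. 0 < s \<Longrightarrow> s < T \<Longrightarrow> V' s \<le> 2 * C * (R s - V s)"
    and R: "\<And>s. s \<in> {0..T} \<Longrightarrow> R s \<ge> 0"
    and meas: "R \<in> borel_measurable (restrict_space borel {0..T})"
    and V0: "V 0 \<ge> 0"
  shows "ennreal (V T) \<le> ennreal (exp (- 2 * C * T)) * ennreal (V 0) + (\<integral>\<^sup>+s. ennreal (R s) \<partial>Lambda C T)"
proof -
  \<comment> \<open>\<open>K\<close> is the normaliser of \<open>Lambda\<close>:
    \<open>K * Lambda_density C T s\<close> equals \<open>2 * C * exp (2 * C * s)\<close>.\<close>
  define K where "K = exp (2 * C * T) - 1"
  have K: "K > 0" using C T by (simp add: K_def)
  define q where "q s = Lambda_density C T s * (indicator {0..T} s * R s)" for s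
  have [measurable]: "Lambda_density C T \<in> borel_measurable borel"
    unfolding Lambda_density_def by measurable
  have [measurable]: "(\<lambda>s. indicator {0..T} s * R s) \<in> borel_measurable borel"
    using meas by (simp add: borel_measurable_restrict_space_iff)
  have q_meas [measurable]: "q \<in> borel_measurable borel" unfolding q_def by measurable
  have dens: "Lambda_density C T s \<ge> 0" for s
    using C K by (simp add: Lambda_density_def K_def[symmetric])
  have q_nonneg: "q s \<ge> 0" for s
    using R dens by (simp add: q_def split: split_indicator)
  have "(\<integral>\<^sup>+s. ennreal (R s) \<partial>Lambda C T) = (\<integral>\<^sup>+s. ennreal (indicator {0..T} s * R s) \<partial>Lambda C T)"
    unfolding Lambda_def
    by (intro nn_integral_cong_AE) (auto simp: AE_density split: split_indicator)
  also have "\<dots> = (\<integral>\<^sup>+s. ennreal (Lambda_density C T s) * indicator {0..T} s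
      * ennreal (indicator {0..T} s * R s) \<partial>lborel)"
    unfolding Lambda_def by (rule nn_integral_density) measurable
  also have "\<dots> = (\<integral>\<^sup>+s. ennreal (q s) \<partial>lborel)"
    by (intro nn_integral_cong) (auto simp: q_def ennreal_mult' dens split: split_indicator)
  finally have Lq: "(\<integral>\<^sup>+s. ennreal (R s) \<partial>Lambda C T) = (\<integral>\<^sup>+s. ennreal (q s) \<partial>lborel)" .
  show ?thesis
  proof (cases "(\<integral>\<^sup>+s. ennreal (q s) \<partial>lborel) = \<infinity>")
    case False
    then have qi: "integrable lborel q"
      using q_nonneg by (intro integrableI_nonneg) (auto simp: less_top)
    define I where "I = integral\<^sup>L lborel q"
    have "(q has_integral I) UNIV" unfolding I_def by (rule has_integral_integral_lborel[OF qi])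
    moreover have "q = (\<lambda>s. if s \<in> {0..T} then q s else 0)"
      by (auto simp: q_def fun_eq_iff)
    ultimately have "(q has_integral I) {0..T}" by (metis has_integral_restrict_UNIV)
    then have hi: "((\<lambda>s. K * q s) has_integral (K * I)) {0..T}" by (rule has_integral_mult_right)
    \<comment> \<open>The derivative of \<open>exp (2 * C * s) * V s\<close> in the interior. The
      value 0 at the endpoints does not affect the integral and stays below \<open>K * q s\<close>,
      which is nonnegative.\<close>
    define W' where "W' s = (if s \<in> {0<..<T} then exp (2 * C * s) * (2 * C * V s + V' s) else 0)" for s
    have "(W' has_integral (exp (2 * C * T) * V T - exp (2 * C * 0) * V 0)) {0..T}"
    proof (rule fundamental_theorem_of_calculus_interior)
      show "continuous_on {0..T} (\<lambda>s. exp (2 * C * s) * V s)"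
        by (intro continuous_intros cont)
      fix s assume s: "s \<in> {0<..<T}"
      have "((\<lambda>s. exp (2 * C * s) * V s) has_real_derivative W' s) (at s)"
        using s der by (auto intro!: derivative_eq_intros simp: W'_def algebra_simps)
      then show "((\<lambda>s. exp (2 * C * s) * V s) has_vector_derivative W' s) (at s)"
        by (simp add: has_real_derivative_iff_has_vector_derivative)
    qed (use T in simp)
    from has_integral_le[OF this hi]
    have "exp (2 * C * T) * V T - V 0 \<le> K * I"
    \<comment> \<open>The chained comparison still has its pointwise premise open; this rule turns
      the premise into a goal, next to the simplification of \<open>exp (2 * C * 0)\<close>.\<close>
    proof (rule order_trans[rotated])
      fix s assume s: "s \<in> {0..T}"
      show "W' s \<le> K * q s"
      proof (cases "s \<in> {0<..<T}")
        case True
        have "W' s \<le> exp (2 * C * s) * (2 * C * R s)"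
          using True le[of s] by (simp add: W'_def right_diff_distrib)
        also have "\<dots> = K * q s"
          using True K by (simp add: q_def Lambda_density_def K_def[symmetric])
        finally show ?thesis .
      next
        case False
        then show ?thesis using K q_nonneg[of s] by (simp add: W'_def del: greaterThanLessThan_iff)
      qed
    qed simp
    then have "V T \<le> exp (- 2 * C * T) * (V 0 + K * I)"
      by (simp add: exp_minus field_simps)
    also have "\<dots> = exp (- 2 * C * T) * V 0 + (exp (- 2 * C * T) * K) * I"
      by (simp add: algebra_simps)
    \<comment> \<open>The exact factor is \<open>1 - exp (- 2 * C * T)\<close>, which is bounded by
      1.\<close>
    also have "(exp (- 2 * C * T) * K) * I \<le> 1 * I"
    proof (rule mult_right_mono)
      show "exp (- 2 * C * T) * K \<le> 1" by (simp add: K_def algebra_simps exp_minus)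
      show "I \<ge> 0" unfolding I_def using q_nonneg by simp
    qed
    finally have "V T \<le> exp (- 2 * C * T) * V 0 + I" by simp
    moreover have "I \<ge> 0" unfolding I_def using q_nonneg by simp
    moreover have "(\<integral>\<^sup>+s. ennreal (q s) \<partial>lborel) = ennreal I"
      unfolding I_def using qi q_nonneg by (intro nn_integral_eq_integral) auto
    ultimately show ?thesis
      unfolding Lq using V0
      by (simp add: ennreal_mult[symmetric] ennreal_plus[symmetric] ennreal_leI del: ennreal_plus)
  qed (simp add: Lq)
qed

subsection \<open>The semigroup on square-integrable functions\<close>

context reversible_markov_semigroup
begin

lemma kernel_subprob [measurable]: "t \<ge> 0 \<Longrightarrow> P t \<in> measurable \<pi> (subprob_algebra \<pi>)"
  by (intro measurable_prob_algebraD kernel)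

lemma prob_space_kernel: "t \<ge> 0 \<Longrightarrow> x \<in> space \<pi> \<Longrightarrow> prob_space (P t x)"
  using measurable_space[OF kernel] by (simp add: space_prob_algebra)

lemma sets_P: "t \<ge> 0 \<Longrightarrow> x \<in> space \<pi> \<Longrightarrow> sets (P t x) = sets \<pi>"
  using measurable_space[OF kernel] by (simp add: space_prob_algebra)

lemma measurable_P:
  "t \<ge> 0 \<Longrightarrow> x \<in> space \<pi> \<Longrightarrow> f \<in> borel_measurable \<pi> \<Longrightarrow> f \<in> borel_measurable (P t x)"
  by (simp add: measurable_cong_sets[OF sets_P refl])

lemma measurable_nn_integral_kernel:
  "t \<ge> 0 \<Longrightarrow> f \<in> borel_measurable \<pi> \<Longrightarrow> (\<lambda>x. \<integral>\<^sup>+y. f y \<partial>P t x) \<in> borel_measurable \<pi>"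
  by (rule measurable_compose[OF kernel_subprob nn_integral_measurable_subprob_algebra])

lemma measurable_semigroup_op:
  "t \<ge> 0 \<Longrightarrow> f \<in> borel_measurable \<pi> \<Longrightarrow> semigroup_op P t f \<in> borel_measurable \<pi>"
  unfolding semigroup_op_def
  by (rule measurable_compose[OF kernel_subprob integral_measurable_subprob_algebra])

section \<open>Detailed balance for densities, and stationarity\<close>

text \<open>Detailed balance is the case of an indicator density. For general \<open>g\<close> this
  case exchanges the roles of \<open>g\<close> and of the indicator of the test set
  \<open>X\<close>, which avoids an approximation by simple functions.\<close>

lemma bind_density:
  assumes t: "t \<ge> 0" and g [measurable]: "g \<in> borel_measurable \<pi>"
  shows "bind (density \<pi> g) (P t) = density \<pi> (\<lambda>x. \<integral>\<^sup>+y. g y \<partial>P t x)"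
proof -
  note [measurable] = measurable_nn_integral_kernel[OF t]
  have K: "P t \<in> measurable (density \<pi> g) (subprob_algebra \<pi>)" for g
    using kernel_subprob[OF t] by (simp cong: measurable_cong_sets)
  have emb: "emeasure (bind (density \<pi> g) (P t)) X = (\<integral>\<^sup>+x. g x * emeasure (P t x) X \<partial>\<pi>)"
    if X: "X \<in> sets \<pi>" and [measurable]: "g \<in> borel_measurable \<pi>" for g X
    using X not_empty
    by (subst emeasure_bind[OF _ K]) (auto intro!: nn_integral_density measurable_emeasure_kernel kernel_subprob t)
  have sb: "sets (bind (density \<pi> g) (P t)) = sets \<pi>" for g
    using not_empty by (intro sets_bind) (auto simp: sets_P t)
  have ind: "bind (density \<pi> (indicator A)) (P t) = density \<pi> (\<lambda>x. emeasure (P t x) A)"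
    if A [measurable]: "A \<in> sets \<pi>" for A
  proof (rule measure_eqI)
    fix B assume "B \<in> sets (bind (density \<pi> (indicator A)) (P t))"
    then have B [measurable]: "B \<in> sets \<pi>" by (simp add: sb)
    show "emeasure (bind (density \<pi> (indicator A)) (P t)) B = emeasure (density \<pi> (\<lambda>x. emeasure (P t x) A)) B"
      using reversible[OF t A B]
      by (simp add: emb emeasure_density measurable_emeasure_kernel[OF kernel_subprob[OF t]] mult.commute)
  qed (simp add: sb)
  show ?thesis
  proof (rule measure_eqI)
    fix X assume "X \<in> sets (bind (density \<pi> g) (P t))"
    then have X [measurable]: "X \<in> sets \<pi>" by (simp add: sb)
    have "emeasure (bind (density \<pi> g) (P t)) X = (\<integral>\<^sup>+x. g x \<partial>density \<pi> (\<lambda>x. emeasure (P t x) X))"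
      by (simp add: emb nn_integral_density measurable_emeasure_kernel[OF kernel_subprob[OF t]] mult.commute)
    \<comment> \<open>By \<open>ind\<close>, the density \<open>emeasure (P t x) X\<close> belongs
      to the measure reached from \<open>\<pi>\<close> restricted to \<open>X\<close>. Integrating
      \<open>g\<close> against it brings in the kernel average of \<open>g\<close>.\<close>
    also have "\<dots> = (\<integral>\<^sup>+x. \<integral>\<^sup>+y. g y \<partial>P t x \<partial>density \<pi> (indicator X))"
      unfolding ind[OF X, symmetric] by (rule nn_integral_bind[OF g K])
    also have "\<dots> = emeasure (density \<pi> (\<lambda>x. \<integral>\<^sup>+y. g y \<partial>P t x)) X"
      by (simp add: nn_integral_density emeasure_density mult.commute)
    finally show "emeasure (bind (density \<pi> g) (P t)) X = emeasure (density \<pi> (\<lambda>x. \<integral>\<^sup>+y. g y \<partial>P t x)) X" .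
  qed (simp add: sb)
qed

text \<open>Both sides integrate \<open>g\<close> against the measure reached at time
  \<open>t\<close> from the density \<open>f\<close>, once by conditioning on the start and once
  through \<open>bind_density\<close>.\<close>

lemma nn_integral_reversible:
  assumes t: "t \<ge> 0" and f [measurable]: "f \<in> borel_measurable \<pi>" and g [measurable]: "g \<in> borel_measurable \<pi>"
  shows "(\<integral>\<^sup>+x. f x * (\<integral>\<^sup>+y. g y \<partial>P t x) \<partial>\<pi>) = (\<integral>\<^sup>+x. (\<integral>\<^sup>+y. f y \<partial>P t x) * g x \<partial>\<pi>)"
proof -
  note [measurable] = measurable_nn_integral_kernel[OF t]
  have K: "P t \<in> measurable (density \<pi> f) (subprob_algebra \<pi>)"
    using kernel_subprob[OF t] by (simp cong: measurable_cong_sets)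
  have "(\<integral>\<^sup>+x. f x * (\<integral>\<^sup>+y. g y \<partial>P t x) \<partial>\<pi>) = (\<integral>\<^sup>+x. g x \<partial>bind (density \<pi> f) (P t))"
    by (subst nn_integral_bind[OF g K]) (simp add: nn_integral_density)
  also have "\<dots> = (\<integral>\<^sup>+x. (\<integral>\<^sup>+y. f y \<partial>P t x) * g x \<partial>\<pi>)"
    by (simp add: bind_density t nn_integral_density)
  finally show ?thesis .
qed

text \<open>This is \<open>bind_density\<close> for the constant density 1, whose kernel averages
  are 1 because the kernels are probability measures.\<close>

lemma stationary:
  assumes t: "t \<ge> 0"
  shows "bind \<pi> (P t) = \<pi>"
proof -
  have "bind (density \<pi> (\<lambda>_. 1)) (P t) = density \<pi> (\<lambda>x. \<integral>\<^sup>+y. 1 \<partial>P t x)"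
    by (rule bind_density[OF t]) simp
  also have "\<dots> = density \<pi> (\<lambda>x. 1)"
  proof (rule density_cong)
    show "AE x in \<pi>. (\<integral>\<^sup>+y. 1 \<partial>P t x) = 1"
      by (rule AE_I2) (simp add: prob_space.emeasure_space_1[OF prob_space_kernel[OF t]])
  qed (auto intro!: measurable_nn_integral_kernel[OF t] simp del: nn_integral_const)
  finally show ?thesis by (simp add: density_1)
qed

lemma nn_integral_stationary:
  assumes t: "t \<ge> 0" and f: "f \<in> borel_measurable \<pi>"
  shows "(\<integral>\<^sup>+x. \<integral>\<^sup>+y. f y \<partial>P t x \<partial>\<pi>) = (\<integral>\<^sup>+x. f x \<partial>\<pi>)"
  using nn_integral_bind[OF f kernel_subprob[OF t]] by (simp add: stationary t)

text \<open>By stationarity a \<open>\<pi>\<close>-null set is null under \<open>P t x\<close> for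
  almost every \<open>x\<close>. This lets the semigroup act on functions modulo null sets.\<close>

lemma AE_kernel:
  assumes t: "t \<ge> 0" and Q: "AE x in \<pi>. Q x"
  shows "AE x in \<pi>. AE y in P t x. Q y"
proof -
  from AE_E[OF Q] obtain N where N: "{x \<in> space \<pi>. \<not> Q x} \<subseteq> N" "emeasure \<pi> N = 0" "N \<in> sets \<pi>"
    by blast
  have "AE x in bind \<pi> (P t). x \<notin> N"
    using N(2,3) by (simp add: stationary t AE_not_in null_setsI)
  then have "AE x in \<pi>. AE y in P t x. y \<notin> N"
    using N(3) by (subst (asm) AE_bind[OF kernel_subprob[OF t]]) auto
  then show ?thesis using AE_space
  proof eventually_elim
    case (elim x)
    have "space (P t x) = space \<pi>" by (rule sets_eq_imp_space_eq[OF sets_P[OF t elim(2)]])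
    then show ?case using elim(1) AE_space[of "P t x"] N(1) by (auto elim!: AE_mp)
  qed
qed

section \<open>Contraction, symmetry and composition in L2\<close>

lemma semigroup_op_cong_AE:
  assumes t: "t \<ge> 0" and [measurable]: "f \<in> borel_measurable \<pi>" "g \<in> borel_measurable \<pi>"
    and eq: "AE x in \<pi>. f x = g x"
  shows "AE x in \<pi>. semigroup_op P t f x = semigroup_op P t g x"
  using AE_kernel[OF t eq] AE_space unfolding semigroup_op_def
  by eventually_elim (intro integral_cong_AE measurable_P t, auto)

text \<open>By stationarity the kernel averages of the square have a finite integral, so they are
  finite almost everywhere. Where \<open>f\<close> is not integrable, \<open>semigroup_op\<close>
  takes the default value 0, so linearity is claimed only almost everywhere.\<close>

lemma AE_kernel_square_integrable:
  assumes t: "t \<ge> 0" and f: "square_integrable \<pi> f"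
  shows "AE x in \<pi>. integrable (P t x) f \<and> integrable (P t x) (\<lambda>y. (f y)\<^sup>2)"
proof -
  note [measurable] = square_integrable_measurable[OF f]
  have "(\<integral>\<^sup>+x. \<integral>\<^sup>+y. ennreal ((f y)\<^sup>2) \<partial>P t x \<partial>\<pi>) = (\<integral>\<^sup>+x. ennreal ((f x)\<^sup>2) \<partial>\<pi>)"
    by (rule nn_integral_stationary[OF t]) measurable
  also have "\<dots> \<noteq> \<infinity>"
    using f by (simp add: square_integrable_def nn_integral_eq_integral)
  finally have "AE x in \<pi>. (\<integral>\<^sup>+y. ennreal ((f y)\<^sup>2) \<partial>P t x) \<noteq> \<infinity>"
    by (intro nn_integral_PInf_AE measurable_nn_integral_kernel t) auto
  then show ?thesis using AE_space
  proof eventually_elim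
    case (elim x)
    interpret Px: prob_space "P t x" by (rule prob_space_kernel[OF t elim(2)])
    have m: "f \<in> borel_measurable (P t x)" by (intro measurable_P t elim) measurable
    have "integrable (P t x) (\<lambda>y. (f y)\<^sup>2)"
      using elim(1) m by (simp add: integrable_iff_bounded less_top)
    then show ?case using Px.square_integrable_imp_integrable[OF m] by blast
  qed
qed

text \<open>Jensen's inequality, in the form of a nonnegative variance under \<open>P t x\<close>,
  followed by stationarity.\<close>

lemma
  assumes t: "t \<ge> 0" and f: "square_integrable \<pi> f"
  shows square_integrable_semigroup_op: "square_integrable \<pi> (semigroup_op P t f)"
    and semigroup_op_contraction: "(\<integral>x. (semigroup_op P t f x)\<^sup>2 \<partial>\<pi>) \<le> (\<integral>x. (f x)\<^sup>2 \<partial>\<pi>)"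
proof -
  note [measurable] = square_integrable_measurable[OF f]
    measurable_semigroup_op[OF t square_integrable_measurable[OF f]]
  have "(\<integral>\<^sup>+x. ennreal ((semigroup_op P t f x)\<^sup>2) \<partial>\<pi>) \<le> (\<integral>\<^sup>+x. \<integral>\<^sup>+y. ennreal ((f y)\<^sup>2) \<partial>P t x \<partial>\<pi>)"
  proof (rule nn_integral_mono_AE, use AE_kernel_square_integrable[OF t f] AE_space in eventually_elim)
    case (elim x)
    interpret Px: prob_space "P t x" by (rule prob_space_kernel[OF t elim(2)])
    have "(semigroup_op P t f x)\<^sup>2 \<le> (\<integral>y. (f y)\<^sup>2 \<partial>P t x)"
      using Px.variance_eq[of f] Px.variance_positive[of f] elim(1) by (simp add: semigroup_op_def)
    then show ?case using elim(1) by (simp add: nn_integral_eq_integral ennreal_leI)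
  qed
  also have "\<dots> = (\<integral>\<^sup>+x. ennreal ((f x)\<^sup>2) \<partial>\<pi>)"
    by (rule nn_integral_stationary[OF t]) measurable
  also have "\<dots> = ennreal (\<integral>x. (f x)\<^sup>2 \<partial>\<pi>)"
    using f by (simp add: square_integrable_def nn_integral_eq_integral)
  finally have le: "(\<integral>\<^sup>+x. ennreal ((semigroup_op P t f x)\<^sup>2) \<partial>\<pi>) \<le> ennreal (\<integral>x. (f x)\<^sup>2 \<partial>\<pi>)" .
  then show sq: "square_integrable \<pi> (semigroup_op P t f)"
    by (simp add: square_integrable_def integrable_iff_bounded order_le_less_trans[OF _ ennreal_less_top])
  then show "(\<integral>x. (semigroup_op P t f x)\<^sup>2 \<partial>\<pi>) \<le> (\<integral>x. (f x)\<^sup>2 \<partial>\<pi>)"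
    using le by (simp add: square_integrable_def nn_integral_eq_integral ennreal_le_iff)
qed

lemma semigroup_op_diff:
  assumes t: "t \<ge> 0" and f: "square_integrable \<pi> f" and g: "square_integrable \<pi> g"
  shows "AE x in \<pi>. semigroup_op P t (\<lambda>y. f y - g y) x = semigroup_op P t f x - semigroup_op P t g x"
  using AE_kernel_square_integrable[OF t f] AE_kernel_square_integrable[OF t g]
  by eventually_elim (simp add: semigroup_op_def)

lemma semigroup_op_zero: "x \<in> space \<pi> \<Longrightarrow> f \<in> borel_measurable \<pi> \<Longrightarrow> semigroup_op P 0 f x = f x"
  by (simp add: semigroup_op_def at_zero integral_return)

lemma semigroup_op_nonneg:
  assumes "t \<ge> 0" "x \<in> space \<pi>" "\<forall>y\<in>space \<pi>. 0 \<le> f y"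
  shows "0 \<le> semigroup_op P t f x"
  unfolding semigroup_op_def
  using assms(3) sets_eq_imp_space_eq[OF sets_P[OF assms(1,2)]] by (intro integral_nonneg_AE AE_I2) simp

text \<open>Links the real-valued operator to extended nonnegative integrals, where reversibility
  and Chapman-Kolmogorov apply without integrability conditions.\<close>

lemma AE_nn_integral_kernel:
  assumes t: "t \<ge> 0" and f: "square_integrable \<pi> f" and nonneg: "\<forall>y\<in>space \<pi>. 0 \<le> f y"
  shows "AE x in \<pi>. (\<integral>\<^sup>+y. ennreal (f y) \<partial>P t x) = ennreal (semigroup_op P t f x)"
  using AE_kernel_square_integrable[OF t f] AE_space
proof eventually_elim
  case (elim x)
  have "AE y in P t x. 0 \<le> f y"
    using nonneg sets_eq_imp_space_eq[OF sets_P[OF t elim(2)]] by (intro AE_I2) simp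
  then show ?case using elim(1) by (simp add: semigroup_op_def nn_integral_eq_integral)
qed

text \<open>Nonnegativity gives direct access to \<open>nn_integral_reversible\<close>; the
  applications are to a density and its images under the semigroup.\<close>

lemma semigroup_op_symmetric:
  assumes t: "t \<ge> 0"
    and f: "square_integrable \<pi> f" "\<forall>y\<in>space \<pi>. 0 \<le> f y"
    and g: "square_integrable \<pi> g" "\<forall>y\<in>space \<pi>. 0 \<le> g y"
  shows "(\<integral>x. f x * semigroup_op P t g x \<partial>\<pi>) = (\<integral>x. semigroup_op P t f x * g x \<partial>\<pi>)"
proof -
  note [measurable] = square_integrable_measurable[OF f(1)] square_integrable_measurable[OF g(1)]
    measurable_semigroup_op[OF t square_integrable_measurable[OF f(1)]]
    measurable_semigroup_op[OF t square_integrable_measurable[OF g(1)]]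
  have "(\<integral>\<^sup>+x. ennreal (f x * semigroup_op P t g x) \<partial>\<pi>)
      = (\<integral>\<^sup>+x. ennreal (f x) * (\<integral>\<^sup>+y. ennreal (g y) \<partial>P t x) \<partial>\<pi>)"
    by (rule nn_integral_cong_AE, use AE_nn_integral_kernel[OF t g] AE_space in eventually_elim)
      (simp add: ennreal_mult f g semigroup_op_nonneg t)
  also have "\<dots> = (\<integral>\<^sup>+x. (\<integral>\<^sup>+y. ennreal (f y) \<partial>P t x) * ennreal (g x) \<partial>\<pi>)"
    by (rule nn_integral_reversible[OF t]) measurable
  also have "\<dots> = (\<integral>\<^sup>+x. ennreal (semigroup_op P t f x * g x) \<partial>\<pi>)"
    by (rule nn_integral_cong_AE, use AE_nn_integral_kernel[OF t f] AE_space in eventually_elim)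
      (simp add: ennreal_mult f g semigroup_op_nonneg t)
  finally show ?thesis
    by (simp add: integral_eq_nn_integral f g semigroup_op_nonneg t)
qed

text \<open>Chapman-Kolmogorov read through nonnegative integrals. The exceptional set at time
  \<open>t\<close> must be null under \<open>P s x\<close> for almost every \<open>x\<close>, which
  \<open>AE_kernel\<close> provides.\<close>

lemma semigroup_op_add:
  assumes s: "s \<ge> 0" and t: "t \<ge> 0"
    and f: "square_integrable \<pi> f" "\<forall>y\<in>space \<pi>. 0 \<le> f y"
  shows "AE x in \<pi>. semigroup_op P s (semigroup_op P t f) x = semigroup_op P (s + t) f x"
proof -
  note st = add_nonneg_nonneg[OF s t]
  note [measurable] = square_integrable_measurable[OF f(1)]
  have nonneg: "\<forall>y\<in>space \<pi>. 0 \<le> semigroup_op P t f y"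
    by (intro ballI semigroup_op_nonneg t f(2))
  from AE_kernel[OF s AE_nn_integral_kernel[OF t f]] AE_nn_integral_kernel[OF st f]
    AE_nn_integral_kernel[OF s square_integrable_semigroup_op[OF t f(1)] nonneg] AE_space
  show ?thesis
  proof eventually_elim
    case (elim x)
    have "ennreal (semigroup_op P (s + t) f x) = (\<integral>\<^sup>+y. \<integral>\<^sup>+z. ennreal (f z) \<partial>P t y \<partial>P s x)"
      unfolding elim(2)[symmetric] chapman_kolmogorov[OF s t elim(4)]
      using kernel_subprob[OF t] sets_P[OF s elim(4)]
      by (intro nn_integral_bind[where B = \<pi>]) (simp_all cong: measurable_cong_sets)
    also have "\<dots> = (\<integral>\<^sup>+y. ennreal (semigroup_op P t f y) \<partial>P s x)"
      by (rule nn_integral_cong_AE[OF elim(1)])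
    also have "\<dots> = ennreal (semigroup_op P s (semigroup_op P t f) x)" by (rule elim(3))
    finally show ?case
      using semigroup_op_nonneg[OF st elim(4) f(2)] semigroup_op_nonneg[OF s elim(4) nonneg]
      by simp
  qed
qed

subsection \<open>Differentiability along the semigroup\<close>

text \<open>For square-integrable \<open>f\<close> this is the Laplace transform of the spectral
  measure of \<open>f\<close> under the generator, which explains the convexity properties proved
  below by elementary means.\<close>

definition autocorrelation :: "('a \<Rightarrow> real) \<Rightarrow> real \<Rightarrow> real" where
  "autocorrelation f s = (\<integral>x. f x * semigroup_op P s f x \<partial>\<pi>)"

context
  fixes f :: "'a \<Rightarrow> real"
  assumes f: "square_integrable \<pi> f" and nonneg: "\<forall>x\<in>space \<pi>. 0 \<le> f x"
begin

abbreviation "ft s \<equiv> semigroup_op P s f"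
abbreviation "\<phi> \<equiv> autocorrelation f"

lemma sq_ft: "s \<ge> 0 \<Longrightarrow> square_integrable \<pi> (ft s)"
  by (rule square_integrable_semigroup_op[OF _ f])

lemma measurable_ft: "s \<ge> 0 \<Longrightarrow> ft s \<in> borel_measurable \<pi>"
  by (rule square_integrable_measurable[OF sq_ft])

text \<open>Symmetry moves both time shifts to one factor, where the semigroup law merges
  them.\<close>

lemma integral_ft_mult:
  assumes a: "a \<ge> 0" and b: "b \<ge> 0"
  shows "(\<integral>x. ft a x * ft b x \<partial>\<pi>) = \<phi> (a + b)"
proof -
  have "(\<integral>x. ft a x * ft b x \<partial>\<pi>) = (\<integral>x. f x * semigroup_op P a (ft b) x \<partial>\<pi>)"
    using nonneg by (intro semigroup_op_symmetric[symmetric] a f sq_ft b) (auto intro: semigroup_op_nonneg b)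
  also have "\<dots> = \<phi> (a + b)"
    unfolding autocorrelation_def
  proof (rule integral_cong_AE)
    show "AE x in \<pi>. f x * semigroup_op P a (ft b) x = f x * ft (a + b) x"
      using semigroup_op_add[OF a b f nonneg] by eventually_elim simp
  qed (use a b in \<open>auto intro!: borel_measurable_times measurable_semigroup_op measurable_ft square_integrable_measurable[OF f]\<close>)
  finally show ?thesis .
qed

lemma integral_ft_diff_mult:
  assumes "a \<ge> 0" "b \<ge> 0" "c \<ge> 0" "d \<ge> 0"
  shows "(\<integral>x. (ft a x - ft b x) * (ft c x - ft d x) \<partial>\<pi>)
    = \<phi> (a + c) - \<phi> (a + d) - \<phi> (b + c) + \<phi> (b + d)"
proof -
  note I = square_integrable_mult[OF sq_ft sq_ft]
  have "(\<lambda>x. (ft a x - ft b x) * (ft c x - ft d x))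
      = (\<lambda>x. ft a x * ft c x - ft a x * ft d x - ft b x * ft c x + ft b x * ft d x)"
    by (auto simp: algebra_simps)
  then show ?thesis
    using assms by (simp add: I integral_ft_mult)
qed

lemma integral_ft_diff_square:
  assumes "a \<ge> 0" "b \<ge> 0"
  shows "(\<integral>x. (ft a x - ft b x)\<^sup>2 \<partial>\<pi>) = \<phi> (2 * a) - 2 * \<phi> (a + b) + \<phi> (2 * b)"
  using integral_ft_diff_mult[OF assms assms] by (simp add: power2_eq_square add.commute[of b a] mult_2[symmetric])

lemma autocorrelation_eq_square: "s \<ge> 0 \<Longrightarrow> \<phi> s = (\<integral>x. (ft (s / 2) x)\<^sup>2 \<partial>\<pi>)"
  using integral_ft_mult[of "s/2" "s/2"] by (simp add: power2_eq_square)

lemma autocorrelation_nonneg: "s \<ge> 0 \<Longrightarrow> \<phi> s \<ge> 0"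
  by (simp add: autocorrelation_eq_square)

text \<open>\<open>\<phi> s\<close> is the squared norm at time \<open>s / 2\<close>, and running
  for a further time \<open>k / 2\<close> is a contraction.\<close>

lemma autocorrelation_antimono:
  assumes s: "s \<ge> 0" and k: "k \<ge> 0"
  shows "\<phi> (s + k) \<le> \<phi> s"
proof -
  have "\<phi> (s + k) = (\<integral>x. (ft (k / 2 + s / 2) x)\<^sup>2 \<partial>\<pi>)"
    using s k by (simp add: autocorrelation_eq_square add_divide_distrib add.commute)
  also have "\<dots> = (\<integral>x. (semigroup_op P (k / 2) (ft (s / 2)) x)\<^sup>2 \<partial>\<pi>)"
  proof (rule integral_cong_AE)
    show "AE x in \<pi>. (ft (k / 2 + s / 2) x)\<^sup>2 = (semigroup_op P (k / 2) (ft (s / 2)) x)\<^sup>2"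
      using semigroup_op_add[OF _ _ f nonneg, of "k/2" "s/2"] s k by auto
  qed (use s k in \<open>auto intro!: borel_measurable_power measurable_semigroup_op measurable_ft square_integrable_measurable[OF f]\<close>)
  also have "\<dots> \<le> \<phi> s"
    using semigroup_op_contraction[OF _ sq_ft, of "k/2" "s/2"] s k by (simp add: autocorrelation_eq_square)
  finally show ?thesis .
qed

lemma autocorrelation_zero: "\<phi> 0 = (\<integral>x. (f x)\<^sup>2 \<partial>\<pi>)"
  unfolding autocorrelation_def
  by (intro Bochner_Integration.integral_cong)
    (simp_all add: semigroup_op_zero square_integrable_measurable[OF f] power2_eq_square)

lemma ft_zero: "x \<in> space \<pi> \<Longrightarrow> ft 0 x = f x"
  by (rule semigroup_op_zero[OF _ square_integrable_measurable[OF f]])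

text \<open>Cauchy-Schwarz bounds an increment over a step \<open>h\<close> by the distance from
  \<open>ft h\<close> to \<open>f\<close>, uniformly in the base point, so strong continuity at time
  0 suffices.\<close>

lemma continuous_on_autocorrelation: "continuous_on {0..} \<phi>"
proof -
  have step: "(\<phi> s - \<phi> (s + h))\<^sup>2 \<le> \<phi> 0 * (\<integral>x. (ft h x - f x)\<^sup>2 \<partial>\<pi>)" if "s \<ge> 0" "h \<ge> 0" for s h
  proof -
    have "\<phi> s - \<phi> (s + h) = (\<integral>x. ft s x * (ft 0 x - ft h x) \<partial>\<pi>)"
      using that square_integrable_mult[OF sq_ft sq_ft, of s]
      by (simp add: right_diff_distrib integral_ft_mult)
    then have "(\<phi> s - \<phi> (s + h))\<^sup>2 \<le> (\<integral>x. (ft s x)\<^sup>2 \<partial>\<pi>) * (\<integral>x. (ft 0 x - ft h x)\<^sup>2 \<partial>\<pi>)"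
      using Cauchy_Schwarz_integral[OF sq_ft square_integrable_diff[OF sq_ft sq_ft], of s 0 h] that
      by simp
    also have "(\<integral>x. (ft 0 x - ft h x)\<^sup>2 \<partial>\<pi>) = (\<integral>x. (ft h x - f x)\<^sup>2 \<partial>\<pi>)"
      by (rule Bochner_Integration.integral_cong[OF refl], subst power2_commute) (simp add: ft_zero)
    also have "(\<integral>x. (ft s x)\<^sup>2 \<partial>\<pi>) * (\<integral>x. (ft h x - f x)\<^sup>2 \<partial>\<pi>)
        \<le> \<phi> 0 * (\<integral>x. (ft h x - f x)\<^sup>2 \<partial>\<pi>)"
      using semigroup_op_contraction[OF that(1) f]
      by (intro mult_right_mono) (simp_all add: autocorrelation_zero)
    finally show ?thesis .
  qed
  have lim: "((\<lambda>h. \<phi> 0 * (\<integral>x. (ft h x - f x)\<^sup>2 \<partial>\<pi>)) \<longlongrightarrow> 0) (at_right 0)"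
    using tendsto_mult[OF tendsto_const strongly_continuous[OF f]] by simp
  show ?thesis
    unfolding continuous_on_iff
  proof (intro ballI allI impI)
    fix s e :: real assume "s \<in> {0..}" "e > 0"
    then have "\<forall>\<^sub>F h in at_right 0. \<phi> 0 * (\<integral>x. (ft h x - f x)\<^sup>2 \<partial>\<pi>) < e\<^sup>2"
      using order_tendstoD(2)[OF lim] by simp
    then obtain d where d: "d > 0"
      "\<And>h. 0 < h \<Longrightarrow> h < d \<Longrightarrow> \<phi> 0 * (\<integral>x. (ft h x - f x)\<^sup>2 \<partial>\<pi>) < e\<^sup>2"
      unfolding eventually_at_right_field by auto
    have close: "\<bar>\<phi> a - \<phi> b\<bar> < e" if "0 \<le> a" "a < b" "b - a < d" for a b
    proof -
      have "(\<phi> a - \<phi> b)\<^sup>2 < e\<^sup>2"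
        using step[of a "b - a"] d(2)[of "b - a"] that by simp
      then show ?thesis using \<open>e > 0\<close> using power_less_imp_less_base[of "\<bar>\<phi> a - \<phi> b\<bar>" 2 e] by simp
    qed
    have "dist (\<phi> s') (\<phi> s) < e" if "s' \<in> {0..}" "dist s' s < d" for s'
      using close[of s s'] close[of s' s] that \<open>s \<in> {0..}\<close> \<open>e > 0\<close>
      by (cases s s' rule: linorder_cases) (auto simp: dist_real_def)
    then show "\<exists>d>0. \<forall>s'\<in>{0..}. dist s' s < d \<longrightarrow> dist (\<phi> s') (\<phi> s) < e"
      using d(1) by blast
  qed
qed

text \<open>Midpoint convexity is the nonnegativity of the squared distance between
  \<open>ft (x/2)\<close> and \<open>ft (y/2)\<close>.\<close>

lemma convex_on_autocorrelation: "convex_on {0..} \<phi>"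
proof (rule midpoint_convex_imp_convex_on[OF _ continuous_on_autocorrelation])
  fix x y :: real assume xy: "x \<in> {0..}" "y \<in> {0..}"
  have "0 \<le> (\<integral>z. (ft (x/2) z - ft (y/2) z)\<^sup>2 \<partial>\<pi>)" by simp
  also have "\<dots> = \<phi> x - 2 * \<phi> ((x + y) / 2) + \<phi> y"
    using xy by (simp add: integral_ft_diff_square add_divide_distrib)
  finally show "\<phi> ((x + y) / 2) \<le> (\<phi> x + \<phi> y) / 2" by simp
qed simp

text \<open>
  Midpoint convexity of \<open>\<phi> s - \<phi> (s + k)\<close> is the inequality \<open>\<langle>w, P\<^sub>k w\<rangle> \<le> \<parallel>w\<parallel>\<^sup>2\<close> for
  \<open>w = P\<^bsub>x/2\<^esub> f - P\<^bsub>y/2\<^esub> f\<close>.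
\<close>

lemma convex_on_autocorrelation_diff:
  assumes k: "k \<ge> 0"
  shows "convex_on {0..} (\<lambda>s. \<phi> s - \<phi> (s + k))"
proof (rule midpoint_convex_imp_convex_on)
  show "continuous_on {0..} (\<lambda>s. \<phi> s - \<phi> (s + k))"
    using k by (intro continuous_intros continuous_on_autocorrelation
        continuous_on_compose2[OF continuous_on_autocorrelation]) auto
  fix x y :: real assume xy: "x \<in> {0..}" "y \<in> {0..}"
  let ?w = "\<lambda>z. ft (x/2) z - ft (y/2) z" and ?v = "\<lambda>z. ft (k + x/2) z - ft (k + y/2) z"
  have w: "square_integrable \<pi> ?w" and v: "square_integrable \<pi> ?v"
    using xy k by (auto intro!: square_integrable_diff sq_ft)
  have "(\<integral>z. (?v z)\<^sup>2 \<partial>\<pi>) = (\<integral>z. (semigroup_op P k ?w z)\<^sup>2 \<partial>\<pi>)"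
  proof (rule integral_cong_AE)
    have "AE z in \<pi>. semigroup_op P k ?w z = semigroup_op P k (ft (x/2)) z - semigroup_op P k (ft (y/2)) z"
      using xy by (intro semigroup_op_diff k sq_ft) auto
    moreover have "AE z in \<pi>. semigroup_op P k (ft (x/2)) z = ft (k + x/2) z"
      "AE z in \<pi>. semigroup_op P k (ft (y/2)) z = ft (k + y/2) z"
      using xy by (auto intro!: semigroup_op_add k f nonneg[rule_format])
    ultimately show "AE z in \<pi>. (?v z)\<^sup>2 = (semigroup_op P k ?w z)\<^sup>2"
      by eventually_elim simp
  qed (auto intro!: borel_measurable_power measurable_semigroup_op k
      square_integrable_measurable[OF w] square_integrable_measurable[OF v])
  also have "\<dots> \<le> (\<integral>z. (?w z)\<^sup>2 \<partial>\<pi>)" by (rule semigroup_op_contraction[OF k w])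
  finally have vw: "(\<integral>z. (?v z)\<^sup>2 \<partial>\<pi>) \<le> (\<integral>z. (?w z)\<^sup>2 \<partial>\<pi>)" .
  \<comment> \<open>Expanding this square bounds twice the inner product by the sum of the squared
    norms, and \<open>vw\<close> replaces the norm of \<open>?v\<close> by that of
    \<open>?w\<close>.\<close>
  have "0 \<le> (\<integral>z. (?w z - ?v z)\<^sup>2 \<partial>\<pi>)" by simp
  also have "\<dots> = (\<integral>z. (?w z)\<^sup>2 - 2 * (?w z * ?v z) + (?v z)\<^sup>2 \<partial>\<pi>)"
    by (intro Bochner_Integration.integral_cong) (auto simp: power2_eq_square algebra_simps)
  also have "\<dots> = (\<integral>z. (?w z)\<^sup>2 \<partial>\<pi>) - 2 * (\<integral>z. ?w z * ?v z \<partial>\<pi>) + (\<integral>z. (?v z)\<^sup>2 \<partial>\<pi>)"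
    using w v square_integrable_mult[OF w v] by (simp add: square_integrable_def)
  finally have "(\<integral>z. ?w z * ?v z \<partial>\<pi>) \<le> (\<integral>z. (?w z)\<^sup>2 \<partial>\<pi>)" using vw by linarith
  then have "\<phi> (x + k) - 2 * \<phi> ((x + y) / 2 + k) + \<phi> (y + k) \<le> \<phi> x - 2 * \<phi> ((x + y) / 2) + \<phi> y"
    using xy k by (simp add: integral_ft_diff_mult integral_ft_diff_square add_ac add_divide_distrib)
  then show "\<phi> ((x + y) / 2) - \<phi> ((x + y) / 2 + k) \<le> (\<phi> x - \<phi> (x + k) + (\<phi> y - \<phi> (y + k))) / 2"
    by simp
qed simp

section \<open>Domain of the generator and the derivative of the autocorrelation\<close>

text \<open>\<open>r\<close> is any measurable version of \<open>ft t\<close>: a relative density is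
  fixed only up to null sets, while \<open>is_generator\<close> speaks of functions.\<close>

lemma difference_quotient_AE:
  assumes t: "t \<ge> 0" and h: "h > 0" and r: "r \<in> borel_measurable \<pi>" "AE x in \<pi>. r x = ft t x"
  shows "AE x in \<pi>. (r x - semigroup_op P h r x) / h = (ft t x - ft (t + h) x) / h"
proof -
  have "AE x in \<pi>. semigroup_op P h r x = semigroup_op P h (ft t) x"
    using h t by (intro semigroup_op_cong_AE r square_integrable_measurable sq_ft) auto
  with r(2) semigroup_op_add[OF _ t f nonneg, of h] h show ?thesis
    by (auto simp: add.commute elim: AE_mp)
qed

lemma difference_quotient_L2:
  assumes t: "t \<ge> 0" and h: "h > 0" and r: "r \<in> borel_measurable \<pi>" "AE x in \<pi>. r x = ft t x"
    and g: "g \<in> borel_measurable \<pi>"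
  shows "(\<integral>x. ((r x - semigroup_op P h r x) / h - g x)\<^sup>2 \<partial>\<pi>) = (\<integral>x. ((ft t x - ft (t + h) x) / h - g x)\<^sup>2 \<partial>\<pi>)"
proof (rule integral_cong_AE)
  show "AE x in \<pi>. ((r x - semigroup_op P h r x) / h - g x)\<^sup>2 = ((ft t x - ft (t + h) x) / h - g x)\<^sup>2"
    using difference_quotient_AE[OF t h r] by eventually_elim (simp only:)
qed (use t h r g in \<open>auto intro!: borel_measurable_power borel_measurable_diff borel_measurable_divide
   measurable_semigroup_op measurable_ft square_integrable_measurable[OF f]\<close>)

text \<open>Inner products of difference quotients converge jointly to some \<open>L\<close>, so
  squared distances tend to \<open>L - 2 * L + L = 0\<close> and completeness yields
  \<open>g\<close>. The base point is \<open>2 * t\<close> because inner products add the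
  times.\<close>

lemma ex_generator:
  assumes t: "t > 0" and r: "r \<in> borel_measurable \<pi>" "AE x in \<pi>. r x = ft t x"
  shows "\<exists>g. is_generator \<pi> P r g"
proof -
  define D where "D h = (\<lambda>x. (ft t x - ft (t + h) x) / h)" for h
  have D: "square_integrable \<pi> (D h)" if "h > 0" for h
    unfolding D_def using t that by (intro square_integrable_divide square_integrable_diff sq_ft) auto
  define F where "F h k = (\<phi> (2*t) - \<phi> (2*t + h) - \<phi> (2*t + k) + \<phi> (2*t + h + k)) / (h * k)" for h k
  have DD: "(\<integral>x. D h x * D k x \<partial>\<pi>) = F h k" if "h > 0" "k > 0" for h k
  proof -
    have "(\<integral>x. D h x * D k x \<partial>\<pi>) = (\<integral>x. (ft t x - ft (t + h) x) * (ft t x - ft (t + k) x) / (h * k) \<partial>\<pi>)"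
      by (simp add: D_def)
    also have "\<dots> = F h k"
    proof -
      have "t + t = 2 * t" "t + (t + k) = 2 * t + k" "t + h + t = 2 * t + h"
        "t + h + (t + k) = 2 * t + h + k" by simp_all
      then show ?thesis using t that by (simp add: integral_ft_diff_mult F_def add.assoc)
    qed
    finally show ?thesis .
  qed
  have dist_D: "(\<integral>x. (D h x - D k x)\<^sup>2 \<partial>\<pi>) = F h h - 2 * F h k + F k k" if "h > 0" "k > 0" for h k
  proof -
    have "(\<lambda>x. (D h x - D k x)\<^sup>2) = (\<lambda>x. D h x * D h x - 2 * (D h x * D k x) + D k x * D k x)"
      by (auto simp: power2_eq_square algebra_simps)
    then show ?thesis
      using that by (simp add: square_integrable_mult D DD)
  qed
  obtain L where L: "\<And>e. e > 0 \<Longrightarrow> \<exists>d>0. \<forall>h k. 0 < h \<and> h < d \<and> 0 < k \<and> k < d \<longrightarrow> \<bar>F h k - L\<bar> < e"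
    using second_difference_quotient_converges[OF convex_on_autocorrelation convex_on_autocorrelation_diff
        autocorrelation_nonneg autocorrelation_antimono, of "2 * t"] t
    unfolding F_def by auto
  have "\<exists>d>0. \<forall>h k. 0 < h \<and> h < d \<and> 0 < k \<and> k < d \<longrightarrow> (\<integral>x. (D h x - D k x)\<^sup>2 \<partial>\<pi>) < e"
    if e: "e > 0" for e
  proof -
    \<comment> \<open>The coefficients 1, 2, 1 in \<open>dist_D\<close> account for the division by
      4.\<close>
    obtain d where d: "d > 0"
      "\<And>h k. 0 < h \<Longrightarrow> h < d \<Longrightarrow> 0 < k \<Longrightarrow> k < d \<Longrightarrow> \<bar>F h k - L\<bar> < e / 4"
      using L[of "e / 4"] e by (metis zero_less_divide_iff zero_less_numeral)
    have "(\<integral>x. (D h x - D k x)\<^sup>2 \<partial>\<pi>) < e" if "0 < h" "h < d" "0 < k" "k < d" for h k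
      using d(2)[of h h] d(2)[of h k] d(2)[of k k] that
      unfolding dist_D[OF that(1,3)] by linarith
    then show ?thesis using d(1) by blast
  qed
  from L2_complete_at_right[OF D this] obtain g where g: "square_integrable \<pi> g"
    "((\<lambda>h. \<integral>x. (D h x - g x)\<^sup>2 \<partial>\<pi>) \<longlongrightarrow> 0) (at_right 0)" by blast
  have "square_integrable \<pi> r"
  proof (rule square_integrable_cong_AE[OF sq_ft r(1)])
    show "AE x in \<pi>. ft t x = r x" using r(2) by eventually_elim simp
  qed (use t in simp)
  moreover
  have "\<forall>\<^sub>F h in at_right 0. (\<integral>x. (D h x - g x)\<^sup>2 \<partial>\<pi>)
      = (\<integral>x. ((r x - semigroup_op P h r x) / h - g x)\<^sup>2 \<partial>\<pi>)"
    using eventually_at_right_less[of 0]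
    by eventually_elim
      (use t in \<open>simp add: difference_quotient_L2[OF _ _ r square_integrable_measurable[OF g(1)]] D_def\<close>)
  from Lim_transform_eventually[OF g(2) this]
  have "((\<lambda>h. \<integral>x. ((r x - semigroup_op P h r x) / h - g x)\<^sup>2 \<partial>\<pi>) \<longlongrightarrow> 0) (at_right 0)" .
  ultimately show ?thesis
    unfolding is_generator_def using g(1) by blast
qed

text \<open>The generator is a right limit only, so both one-sided quotients are written with the
  same forward quotient \<open>D h\<close>: paired with \<open>ft t\<close> for the right derivative
  and with \<open>ft (t - h)\<close> for the left one.\<close>

lemma autocorrelation_derivative:
  assumes t: "t > 0" and r: "AE x in \<pi>. r x = ft t x" and gen: "is_generator \<pi> P r g"
  shows "(\<phi> has_real_derivative - (\<integral>x. r x * g x \<partial>\<pi>)) (at (2 * t))"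
proof -
  have rsq: "square_integrable \<pi> r" and g: "square_integrable \<pi> g"
    and lim: "((\<lambda>h. \<integral>x. ((r x - semigroup_op P h r x) / h - g x)\<^sup>2 \<partial>\<pi>) \<longlongrightarrow> 0) (at_right 0)"
    using gen by (auto simp: is_generator_def)
  note rm = square_integrable_measurable[OF rsq] and gm = square_integrable_measurable[OF g]
  define D where "D h = (\<lambda>x. (ft t x - ft (t + h) x) / h)" for h
  have pos: "\<forall>\<^sub>F h in at_right (0::real). 0 < h \<and> h < t"
    using t by (auto simp: eventually_at_right_field)
  have Dsq: "\<forall>\<^sub>F h in at_right 0. square_integrable \<pi> (D h)"
    using pos by eventually_elim
      (use t in \<open>auto simp: D_def intro!: square_integrable_divide square_integrable_diff sq_ft\<close>)
  have "\<forall>\<^sub>F h in at_right 0. (\<integral>x. ((r x - semigroup_op P h r x) / h - g x)\<^sup>2 \<partial>\<pi>)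
      = (\<integral>x. (D h x - g x)\<^sup>2 \<partial>\<pi>)"
    using pos by eventually_elim (use t in \<open>simp add: difference_quotient_L2[OF _ _ rm r gm] D_def\<close>)
  from Lim_transform_eventually[OF lim this]
  have Dg: "((\<lambda>h. \<integral>x. (D h x - g x)\<^sup>2 \<partial>\<pi>) \<longlongrightarrow> 0) (at_right 0)" .
  have rg: "(\<integral>x. ft t x * g x \<partial>\<pi>) = (\<integral>x. r x * g x \<partial>\<pi>)"
  proof (rule integral_cong_AE)
    show "AE x in \<pi>. ft t x * g x = r x * g x" using r by eventually_elim simp
  qed (use t rm gm in \<open>auto intro!: borel_measurable_times measurable_ft\<close>)
  have ftD: "(\<integral>x. ft a x * D h x \<partial>\<pi>) = (\<phi> b - \<phi> (b + h)) / h"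
    if "a \<ge> 0" "h > 0" "b = a + t" for a b h
  proof -
    have "(\<lambda>x. ft a x * D h x) = (\<lambda>x. (ft a x * ft t x - ft a x * ft (t + h) x) / h)"
      by (auto simp: D_def algebra_simps)
    then show ?thesis
      using that t by (simp add: square_integrable_mult sq_ft integral_ft_mult add_ac)
  qed
  have right: "((\<lambda>h. (\<phi> (2 * t + h) - \<phi> (2 * t)) / h) \<longlongrightarrow> - (\<integral>x. r x * g x \<partial>\<pi>)) (at_right 0)"
  proof (rule Lim_transform_eventually)
    show "((\<lambda>h. - (\<integral>x. ft t x * D h x \<partial>\<pi>)) \<longlongrightarrow> - (\<integral>x. r x * g x \<partial>\<pi>)) (at_right 0)"
      unfolding rg[symmetric] using t Dsq Dg g
      by (intro tendsto_minus tendsto_integral_mult_L2) (auto intro: sq_ft)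
    show "\<forall>\<^sub>F h in at_right 0. - (\<integral>x. ft t x * D h x \<partial>\<pi>) = (\<phi> (2 * t + h) - \<phi> (2 * t)) / h"
      using pos by eventually_elim (use t in \<open>simp add: ftD[of t _ "2 * t"] diff_divide_distrib\<close>)
  qed
  have cont: "isCont \<phi> (2 * t)"
    using t by (intro continuous_on_interior[OF continuous_on_autocorrelation]) simp
  \<comment> \<open>This expression is the squared distance between \<open>ft (t - h)\<close> and
    \<open>ft t\<close>, so continuity of \<open>\<phi>\<close> gives left continuity of the orbit
    at \<open>t\<close>.\<close>
  have "((\<lambda>h. \<phi> (2 * t - 2 * h) - 2 * \<phi> (2 * t - h) + \<phi> (2 * t))
      \<longlongrightarrow> \<phi> (2 * t) - 2 * \<phi> (2 * t) + \<phi> (2 * t)) (at_right 0)"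
  proof (intro tendsto_intros isCont_tendsto_compose[OF cont])
    show "((\<lambda>h. 2 * t - 2 * h) \<longlongrightarrow> 2 * t) (at_right 0)" by (auto intro!: tendsto_eq_intros)
    show "((\<lambda>h. 2 * t - h) \<longlongrightarrow> 2 * t) (at_right 0)" by (auto intro!: tendsto_eq_intros)
  qed
  moreover have "\<forall>\<^sub>F h in at_right 0. \<phi> (2 * t - 2 * h) - 2 * \<phi> (2 * t - h) + \<phi> (2 * t)
      = (\<integral>x. (ft (t - h) x - ft t x)\<^sup>2 \<partial>\<pi>)"
    using pos
  proof eventually_elim
    case (elim h)
    have "t - h + t = 2 * t - h" by simp
    then show ?case using elim t by (simp add: integral_ft_diff_square right_diff_distrib)
  qed
  ultimately have ftc: "((\<lambda>h. \<integral>x. (ft (t - h) x - ft t x)\<^sup>2 \<partial>\<pi>) \<longlongrightarrow> 0) (at_right 0)"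
    by (auto dest: Lim_transform_eventually)
  have left: "((\<lambda>h. (\<phi> (2 * t + - h) - \<phi> (2 * t)) / - h) \<longlongrightarrow> - (\<integral>x. r x * g x \<partial>\<pi>)) (at_right 0)"
  proof (rule Lim_transform_eventually)
    have "\<forall>\<^sub>F h in at_right 0. square_integrable \<pi> (ft (t - h))"
      using pos by eventually_elim (auto intro: sq_ft)
    then show "((\<lambda>h. - (\<integral>x. ft (t - h) x * D h x \<partial>\<pi>)) \<longlongrightarrow> - (\<integral>x. r x * g x \<partial>\<pi>)) (at_right 0)"
      unfolding rg[symmetric] using t Dsq Dg g ftc
      by (intro tendsto_minus tendsto_integral_mult_L2) (auto intro: sq_ft)
    show "\<forall>\<^sub>F h in at_right 0. - (\<integral>x. ft (t - h) x * D h x \<partial>\<pi>) = (\<phi> (2 * t + - h) - \<phi> (2 * t)) / - h"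
      using pos by eventually_elim (simp add: ftD[of "t - _" _ "2 * t - _"] diff_divide_distrib)
  qed
  show ?thesis
    unfolding DERIV_def
    by (rule filterlim_split_at) (use left right in \<open>simp_all add: filterlim_at_left_to_right\<close>)
qed

end

subsection \<open>Densities of the laws\<close>

text \<open>Through \<open>bind_density\<close>, reversibility makes the density evolve by the
  semigroup itself rather than by its adjoint.\<close>

lemma law_at_density:
  assumes t: "t \<ge> 0" and f: "square_integrable \<pi> f" and nonneg: "\<forall>x\<in>space \<pi>. 0 \<le> f x"
  shows "law_at P (density \<pi> f) t = density \<pi> (semigroup_op P t f)"
proof -
  note [measurable] = square_integrable_measurable[OF f]
  have "law_at P (density \<pi> f) t = density \<pi> (\<lambda>x. \<integral>\<^sup>+y. f y \<partial>P t x)"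
    unfolding law_at_def by (rule bind_density[OF t]) measurable
  also have "\<dots> = density \<pi> (semigroup_op P t f)"
    using measurable_semigroup_op[OF t square_integrable_measurable[OF f]]
    by (intro density_cong measurable_nn_integral_kernel t AE_nn_integral_kernel f nonneg) measurable
  finally show ?thesis .
qed

lemma rel_density_density:
  assumes [measurable]: "u \<in> borel_measurable \<pi>" and "\<forall>x\<in>space \<pi>. 0 \<le> u x"
  shows "AE x in \<pi>. rel_density \<pi> (density \<pi> u) x = u x"
proof -
  have "AE x in \<pi>. ennreal (u x) = RN_deriv \<pi> (density \<pi> u) x"
    by (rule RN_deriv_unique) simp_all
  then show ?thesis using AE_space
  proof eventually_elim
    case (elim x)
    then show ?case using assms(2) by (metis enn2real_ennreal rel_density_def)
  qed
qed

lemma measurable_rel_density: "rel_density \<pi> \<nu> \<in> borel_measurable \<pi>"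
  unfolding rel_density_def by measurable

text \<open>A probability density has mean 1, so centring takes exactly 1 off the second moment.
  Passing from \<open>u\<close> to \<open>rel_density\<close> changes only a null set.\<close>

lemma
  assumes u: "square_integrable \<pi> u" and nonneg: "\<forall>x\<in>space \<pi>. 0 \<le> u x"
    and prob: "prob_space (density \<pi> u)"
  shows variance_rel_density: "variance (rel_density \<pi> (density \<pi> u)) = (\<integral>x. (u x)\<^sup>2 \<partial>\<pi>) - 1"
    and chi_square_density: "chi_square \<pi> (density \<pi> u) = ennreal ((\<integral>x. (u x)\<^sup>2 \<partial>\<pi>) - 1)"
proof -
  note [measurable] = square_integrable_measurable[OF u] measurable_rel_density
  let ?r = "rel_density \<pi> (density \<pi> u)"
  have r: "AE x in \<pi>. ?r x = u x" by (rule rel_density_density[OF _ nonneg]) measurable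
  have "(\<integral>\<^sup>+x. ennreal (u x) \<partial>\<pi>) = 1"
    using prob_space.emeasure_space_1[OF prob] by (simp add: emeasure_density cong: nn_integral_cong)
  then have "expectation u = 1"
    using nonneg by (subst integral_eq_nn_integral) auto
  moreover have "expectation ?r = expectation u" using r by (intro integral_cong_AE) auto
  ultimately have Er: "expectation ?r = 1" by simp
  have rsq: "square_integrable \<pi> ?r"
    by (rule square_integrable_cong_AE[OF u]) (use r in auto)
  then have int: "integrable \<pi> ?r" "integrable \<pi> (\<lambda>x. (?r x)\<^sup>2)"
    using rsq unfolding square_integrable_def by (blast intro: square_integrable_imp_integrable)+
  have "expectation (\<lambda>x. (?r x)\<^sup>2) = (\<integral>x. (u x)\<^sup>2 \<partial>\<pi>)" using r by (intro integral_cong_AE) auto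
  then show var: "variance ?r = (\<integral>x. (u x)\<^sup>2 \<partial>\<pi>) - 1"
    using variance_eq[OF int] Er by simp
  have "integrable \<pi> (\<lambda>x. (?r x - expectation ?r)\<^sup>2)"
    using int by (simp add: power2_diff)
  then show "chi_square \<pi> (density \<pi> u) = ennreal ((\<integral>x. (u x)\<^sup>2 \<partial>\<pi>) - 1)"
    unfolding chi_square_def
    by (simp add: absolutely_continuousI_density nn_integral_eq_integral var)
qed

text \<open>A finite value forces absolute continuity, so the Radon-Nikodym theorem applies. Unit
  mass makes the derivative finite almost everywhere, hence \<open>enn2real\<close> loses
  nothing.\<close>

lemma finite_chi_square_density:
  assumes \<nu>: "prob_space \<nu>" "sets \<nu> = sets \<pi>" and fin: "chi_square \<pi> \<nu> \<noteq> \<infinity>"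
  shows "\<nu> = density \<pi> (rel_density \<pi> \<nu>)" and "square_integrable \<pi> (rel_density \<pi> \<nu>)"
proof -
  let ?r = "rel_density \<pi> \<nu>"
  note [measurable] = measurable_rel_density
  have ac: "absolutely_continuous \<pi> \<nu>"
    and fin': "(\<integral>\<^sup>+x. ennreal ((?r x - expectation ?r)\<^sup>2) \<partial>\<pi>) \<noteq> \<infinity>"
    using fin by (auto simp: chi_square_def split: if_splits)
  have dens: "density \<pi> (RN_deriv \<pi> \<nu>) = \<nu>" by (rule density_RN_deriv[OF ac \<nu>(2)])
  have "emeasure (density \<pi> (RN_deriv \<pi> \<nu>)) (space \<pi>) = 1"
    unfolding dens using prob_space.emeasure_space_1[OF \<nu>(1)] sets_eq_imp_space_eq[OF \<nu>(2)] by simp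
  then have "(\<integral>\<^sup>+x. RN_deriv \<pi> \<nu> x \<partial>\<pi>) \<noteq> \<infinity>"
    by (simp add: emeasure_density cong: nn_integral_cong)
  then have "AE x in \<pi>. RN_deriv \<pi> \<nu> x \<noteq> \<infinity>" by (intro nn_integral_PInf_AE) auto
  then have "AE x in \<pi>. RN_deriv \<pi> \<nu> x = ennreal (?r x)"
    by eventually_elim (simp add: rel_density_def less_top)
  then have "density \<pi> (RN_deriv \<pi> \<nu>) = density \<pi> (\<lambda>x. ennreal (?r x))"
    by (intro density_cong) auto
  with dens show "\<nu> = density \<pi> ?r" by simp
  have "square_integrable \<pi> (\<lambda>x. ?r x - expectation ?r)"
    using fin' by (simp add: square_integrable_def integrable_iff_bounded less_top)
  moreover have "square_integrable \<pi> (\<lambda>x. - expectation ?r)" by (simp add: square_integrable_def)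
  ultimately have "square_integrable \<pi> (\<lambda>x. (?r x - expectation ?r) - (- expectation ?r))"
    by (rule square_integrable_diff)
  then show "square_integrable \<pi> ?r" by simp
qed

end

section \<open>Decay of the chi-square divergence along the chain\<close>

theorem theorem4p6:
  fixes \<pi> \<nu>0 :: "'a measure" and P :: "real \<Rightarrow> 'a \<Rightarrow> 'a measure"
    and Adm :: "('a \<Rightarrow> real) set" and Error :: "('a \<Rightarrow> real) \<Rightarrow> real" and CP T :: real
  assumes chain: "reversible_markov_semigroup \<pi> P"
    and init: "prob_space \<nu>0" "sets \<nu>0 = sets \<pi>"
    and CP: "CP > 0"
    and wpi: "weak_poincare \<pi> P Adm CP Error"
    and T: "T > 0"
    and adm: "\<And>s. s \<in> {0..T} \<Longrightarrow> rel_density \<pi> (law_at P \<nu>0 s) \<in> Adm"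
    and meas: "(\<lambda>s. Error (rel_density \<pi> (law_at P \<nu>0 s)))
                 \<in> borel_measurable (restrict_space borel {0..T})"
  shows "chi_square \<pi> (law_at P \<nu>0 T)
      \<le> ennreal (exp (- 2 * CP * T)) * chi_square \<pi> \<nu>0
        + (\<integral>\<^sup>+s. ennreal (Error (rel_density \<pi> (law_at P \<nu>0 s))) \<partial>Lambda CP T)"
proof (cases "chi_square \<pi> \<nu>0 = \<infinity>")
  \<comment> \<open>The exponential factor is positive, so the right-hand side is infinite.\<close>
  case True
  then show ?thesis by (simp add: ennreal_mult_top)
next
  case False
  interpret reversible_markov_semigroup \<pi> P by (rule chain)
  define f where "f = rel_density \<pi> \<nu>0"
  have \<nu>0: "\<nu>0 = density \<pi> f" and f: "square_integrable \<pi> f"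
    using finite_chi_square_density[OF init False] by (simp_all add: f_def)
  have nonneg: "\<forall>x\<in>space \<pi>. 0 \<le> f x" by (simp add: f_def rel_density_def)
  \<comment> \<open>\<open>u s\<close> is the semigroup image, and \<open>r s\<close> below is the
    version of the same density that \<open>Error\<close> and \<open>Adm\<close> refer to; they are
    shown to agree only almost everywhere.\<close>
  define u where "u s = semigroup_op P s f" for s
  define r where "r s = rel_density \<pi> (law_at P \<nu>0 s)" for s
  define V where "V s = autocorrelation f (2 * s) - 1" for s
  have law: "law_at P \<nu>0 s = density \<pi> (u s)" if "s \<ge> 0" for s
    unfolding \<nu>0 u_def by (rule law_at_density[OF that f nonneg])
  have u: "square_integrable \<pi> (u s)" "\<forall>x\<in>space \<pi>. 0 \<le> u s x" "prob_space (density \<pi> (u s))"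
    "(\<integral>x. (u s x)\<^sup>2 \<partial>\<pi>) - 1 = V s" if s: "s \<ge> 0" for s
  proof -
    show "square_integrable \<pi> (u s)" unfolding u_def by (rule square_integrable_semigroup_op[OF s f])
    show "\<forall>x\<in>space \<pi>. 0 \<le> u s x" unfolding u_def by (intro ballI semigroup_op_nonneg s nonneg)
    have "\<nu>0 \<in> space (prob_algebra \<pi>)" using init by (simp add: space_prob_algebra)
    then show "prob_space (density \<pi> (u s))"
      unfolding law[OF s, symmetric] law_at_def by (rule prob_space_bind'[OF _ kernel[OF s]])
    show "(\<integral>x. (u s x)\<^sup>2 \<partial>\<pi>) - 1 = V s"
      using autocorrelation_eq_square[OF f nonneg, of "2 * s"] s by (simp add: V_def u_def)
  qed
  have r: "AE x in \<pi>. r s x = u s x" if "s \<ge> 0" for s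
    unfolding r_def law[OF that]
    by (rule rel_density_density[OF square_integrable_measurable[OF u(1)] u(2)]) (use that in auto)
  have r_meas: "r s \<in> borel_measurable \<pi>" for s unfolding r_def by (rule measurable_rel_density)
  have chi: "chi_square \<pi> (density \<pi> (u s)) = ennreal (V s)" if "s \<ge> 0" for s
    using chi_square_density[OF u(1-3)] u(4) that by simp
  have V_nonneg: "V s \<ge> 0" if "s \<ge> 0" for s
    using variance_rel_density[OF u(1-3)] u(4) that variance_positive by metis
  \<comment> \<open>At time 0 the density is unchanged on the space, since \<open>P 0 x\<close> is
    the point mass at \<open>x\<close>.\<close>
  have chi0: "chi_square \<pi> \<nu>0 = ennreal (V 0)"
  proof -
    have "\<nu>0 = density \<pi> (u 0)"
      unfolding \<nu>0 u_def using measurable_semigroup_op[OF _ square_integrable_measurable[OF f], of 0]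
        square_integrable_measurable[OF f]
      by (intro density_cong AE_I2) (simp_all add: semigroup_op_zero)
    then show ?thesis using chi[of 0] by simp
  qed
  \<comment> \<open>The factor 2 is the inner derivative, as \<open>V s\<close> evaluates the
    autocorrelation at \<open>2 * s\<close>.\<close>
  define V' where "V' s = - 2 * dirichlet_form \<pi> P (r s) (r s)" for s
  have gen: "is_generator \<pi> P (r s) (generator \<pi> P (r s))" if "s > 0" for s
  proof -
    have "\<exists>g. is_generator \<pi> P (r s) g"
      by (rule ex_generator[OF f nonneg that r_meas]) (use r[of s] that in \<open>simp add: u_def\<close>)
    then show ?thesis unfolding generator_def by (rule someI_ex)
  qed
  have "ennreal (V T) \<le> ennreal (exp (- 2 * CP * T)) * ennreal (V 0)
      + (\<integral>\<^sup>+s. ennreal (Error (r s)) \<partial>Lambda CP T)"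
  proof (rule Gronwall_Lambda[OF CP T])
    show "continuous_on {0..T} V"
      unfolding V_def
      by (intro continuous_intros continuous_on_compose2[OF continuous_on_autocorrelation[OF f nonneg]]) auto
    show "(V has_real_derivative V' s) (at s)" if "0 < s" "s < T" for s
    proof -
      have "AE x in \<pi>. r s x = semigroup_op P s f x" using r[of s] that by (simp add: u_def)
      from autocorrelation_derivative[OF f nonneg that(1) this gen[OF that(1)]]
      have "(autocorrelation f has_real_derivative - dirichlet_form \<pi> P (r s) (r s)) (at (2 * s))"
        by (simp add: dirichlet_form_def)
      then show ?thesis
        unfolding V_def V'_def by (auto intro!: derivative_eq_intros DERIV_chain2)
    qed
    show "V' s \<le> 2 * CP * (Error (r s) - V s)" if "0 < s" "s < T" for s
    proof -
      have "r s \<in> Adm \<inter> generator_domain \<pi> P"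
        using adm[of s] gen[of s] that by (auto simp: r_def generator_domain_def)
      then have "variance (r s) \<le> 1 / CP * dirichlet_form \<pi> P (r s) (r s) + Error (r s)"
        using wpi by (simp add: weak_poincare_def)
      moreover have "variance (r s) = V s"
        using variance_rel_density[OF u(1-3)] u(4) that by (simp add: r_def law)
      ultimately have "CP * (V s - Error (r s)) \<le> CP * (1 / CP * dirichlet_form \<pi> P (r s) (r s))"
        using CP by (intro mult_left_mono) auto
      then show ?thesis using CP by (simp add: V'_def algebra_simps)
    qed
    show "Error (r s) \<ge> 0" if "s \<in> {0..T}" for s
      using wpi adm[OF that] by (simp add: weak_poincare_def r_def)
  qed (use meas V_nonneg in \<open>simp_all add: r_def\<close>)
  then show ?thesis
    using T law[of T] chi[of T] chi0 by (simp add: r_def)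
qed

end
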